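(* For $i\in\{N,D\}$, let $r_{\Omega,i}$ be the exact solution of the adjoint problem, $r_{\Omega,i}^h$ its Finite Element approximation, and $\xi_{\Omega,i}^h$ the Raviart-Thomas approximation of the adjoint dual flux, all as defined in the context. Then $$ |\!|\!| r_{\Omega,i} - r_{\Omega,i}^h |\!|\!|_{\Omega}^2 \leq \int_{\mathcal{D}} \Big( k_\Omega^{-1} | \xi_{\Omega,i}^h + k_\Omega M(\theta^h)\nabla u_{\Omega,i}^h - k_\Omega \nabla r_{\Omega,i}^h|^2 + |\nabla \cdot \xi_{\Omega,i}^h - (\nabla\cdot\theta^h) u_{\Omega,i}^h - r_{\Omega,i}^h|^2 \Big)\, dx , \qquad i=N,D. $$
   Context: Let $\mathcal{D}\subset\mathbb{R}^2$ be a bounded open domain with Lipschitz boundary and outward unit normal $n$, and $\Omega\subset\subset\mathcal{D}$ an open subdomain with Lipschitz boundary. Let $k_I,k_E>0$ and $k_\Omega = k_I\chi_\Omega + k_E(1-\chi_\Omega)$, where $\chi_\Omega$ is the characteristic function of $\Omega$. Let $g\in L^2(\partial\mathcal{D})$ and $U_D\in H^{1/2}(\partial\mathcal{D})$. Set $V_N=H^1(\mathcal{D})$, $V_D=H^1_0(\mathcal{D})$, $$a_\Omega(u,v)=\int_{\mathcal{D}}\big(k_\Omega\nabla u\cdot\nabla v+uv\big)\,dx,\qquad F_{\Omega,N}(v)=\int_{\partial\mathcal{D}} g v\,ds,\qquad F_{\Omega,D}(v)=0,$$ and let $|\!|\!| v|\!|\!|_\Omega = a_\Omega(v,v)^{1/2}$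 be the energy norm. Discrete states: for finite-dimensional Lagrangian Finite Element spaces $V_i^h\subset V_i$, $u_{\Omega,i}^h\in H^1(\mathcal{D})$ is a Lagrangian Finite Element function, with $u_{\Omega,N}^h\in V_N^h$ and $u_{\Omega,D}^h=U_D$ on $\partial\mathcal{D}$, satisfying $a_\Omega(u_{\Omega,i}^h,v)=F_{\Omega,i}(v)$ for all $v\in V_i^h$, $i=N,D$. Let $\theta^h\in W^{1,\infty}(\mathcal{D};\mathbb{R}^2)$ be a (Finite Element) deformation field with $\theta^h=0$ on $\partial\mathcal{D}$, and $M(\theta)=\nabla\theta+\nabla\theta^T-(\nabla\cdot\theta)\operatorname{Id}$. Define $$\langle G(\Omega,u),\theta\rangle=\frac12\int_{\mathcal{D}}\Big(k_\Omega M(\theta)\nabla u\cdot\nabla u-(\nabla\cdot\theta)u^2\Big)dx$$ and $$H_{\Omega,i}(v)=\frac{\partial G}{\partial u}(\Omega,u_{\Omega,i}^h)[\theta^h,v]=\int_{\mathcal{D}}\Big(k_\Omega M(\theta^h)\nabla u_{\Omega,i}^h\cdot\nabla v-(\nabla\cdot\theta^h)u_{\Omega,i}^h v\Big)dx .$$ Adjoint problems: $r_{\Omega,i}\in V_i$ solves $a_\Omega(v,r_{\Omega,i})=H_{\Omega,i}(v)$ for all $v\in V_i$; $r_{\Omega,i}^h\in V_i^h$ solves $a_\Omega(v,r_{\Omega,i}^h)=H_{\Omega,i}(v)$ for all $v\in V_i^h$. Adjoint dual fluxes: let $H(\operatorname{div})=\{\xi\in L^2(\mathcal{D};\mathbb{R}^2):\nabla\cdot\xi\in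 L^2(\mathcal{D})\}$ and let $\Sigma^h\subset H(\operatorname{div})$ be a Raviart-Thomas Finite Element space on a triangulation of $\mathcal{D}$ (the error in the approximation of the geometry is neglected). The discrete flux $\xi_{\Omega,i}^h\in\Sigma^h$, with $\xi_{\Omega,N}^h\cdot n=0$ on $\partial\mathcal{D}$, satisfies $$\int_{\mathcal{D}}\Big(k_\Omega^{-1}\xi_{\Omega,i}^h\cdot\delta\xi+(\nabla\cdot\xi_{\Omega,i}^h)(\nabla\cdot\delta\xi)\Big)dx=\int_{\mathcal{D}}\Big((\nabla\cdot\theta^h)u_{\Omega,i}^h\,\nabla\cdot\delta\xi-M(\theta^h)\nabla u_{\Omega,i}^h\cdot\delta\xi\Big)dx$$ for all $\delta\xi\in\Sigma^h$, with additionally $\delta\xi\cdot n=0$ on $\partial\mathcal{D}$ when $i=N$. *)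

theory Defs
  imports "HOL-Analysis.Analysis"
begin

text \<open>
  Elements of function spaces are represented by functions on the whole plane; only their
  values on the set in question, up to null sets, matter.
\<close>

section \<open>Lebesgue spaces\<close>

definition L2 :: "'a measure \<Rightarrow> ('a \<Rightarrow> 'b::euclidean_space) set" where
  "L2 M = {f. f \<in> borel_measurable M \<and> integrable M (\<lambda>x. (norm (f x))\<^sup>2)}"

definition Linf :: "'a measure \<Rightarrow> ('a \<Rightarrow> 'b::euclidean_space) set" where
  "Linf M = {f. f \<in> borel_measurable M \<and> (\<exists>B. AE x in M. norm (f x) \<le> B)}"

definition L2_tendsto ::
    "'a measure \<Rightarrow> (nat \<Rightarrow> 'a \<Rightarrow> 'b::euclidean_space) \<Rightarrow> ('a \<Rightarrow> 'b) \<Rightarrow> bool" where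
  "L2_tendsto M f g \<longleftrightarrow> (\<lambda>n. \<integral>\<^sup>+x. ennreal ((norm (f n x - g x))\<^sup>2) \<partial>M) \<longlonglongrightarrow> 0"

definition locally_integrable :: "(real^2) set \<Rightarrow> (real^2 \<Rightarrow> 'b::euclidean_space) \<Rightarrow> bool" where
  "locally_integrable D f \<longleftrightarrow> (\<forall>K. compact K \<and> K \<subseteq> D \<longrightarrow> f absolutely_integrable_on K)"


section \<open>Smooth functions and weak derivatives\<close>

definition grad :: "(real^2 \<Rightarrow> real) \<Rightarrow> real^2 \<Rightarrow> real^2" where
  "grad f x = (\<chi> j. frechet_derivative f (at x) (axis j 1))"

primrec C_k :: "nat \<Rightarrow> (real^2 \<Rightarrow> real) \<Rightarrow> bool" where
  "C_k 0 f \<longleftrightarrow> continuous_on UNIV f"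
| "C_k (Suc k) f \<longleftrightarrow> (\<forall>x. f differentiable (at x)) \<and> (\<forall>j. C_k k (\<lambda>x. grad f x $ j))"

definition smooth :: "(real^2 \<Rightarrow> real) \<Rightarrow> bool" where
  "smooth f \<longleftrightarrow> (\<forall>k. C_k k f)"

definition test_functions :: "(real^2) set \<Rightarrow> (real^2 \<Rightarrow> real) set" where
  "test_functions D =
     {\<phi>. smooth \<phi> \<and> compact (closure {x. \<phi> x \<noteq> 0}) \<and> closure {x. \<phi> x \<noteq> 0} \<subseteq> D}"

definition has_weak_grad ::
    "(real^2) set \<Rightarrow> (real^2 \<Rightarrow> real) \<Rightarrow> (real^2 \<Rightarrow> real^2) \<Rightarrow> bool" where
  "has_weak_grad D u G \<longleftrightarrow> locally_integrable D u \<and> locally_integrable D G \<and>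
     (\<forall>\<phi>\<in>test_functions D. \<forall>j.
        (LINT x|lebesgue_on D. u x * grad \<phi> x $ j) = - (LINT x|lebesgue_on D. G x $ j * \<phi> x))"

definition has_weak_div ::
    "(real^2) set \<Rightarrow> (real^2 \<Rightarrow> real^2) \<Rightarrow> (real^2 \<Rightarrow> real) \<Rightarrow> bool" where
  "has_weak_div D \<xi> d \<longleftrightarrow> locally_integrable D \<xi> \<and> locally_integrable D d \<and>
     (\<forall>\<phi>\<in>test_functions D.
        (LINT x|lebesgue_on D. \<xi> x \<bullet> grad \<phi> x) = - (LINT x|lebesgue_on D. d x * \<phi> x))"

text \<open>Weak derivatives are unique almost everywhere, so the choices below are immaterial.\<close>

definition wgrad :: "(real^2) set \<Rightarrow> (real^2 \<Rightarrow> real) \<Rightarrow> real^2 \<Rightarrow> real^2" where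
  "wgrad D u = (SOME G. has_weak_grad D u G)"

definition wdiv :: "(real^2) set \<Rightarrow> (real^2 \<Rightarrow> real^2) \<Rightarrow> real^2 \<Rightarrow> real" where
  "wdiv D \<xi> = (SOME d. has_weak_div D \<xi> d)"

definition wjac :: "(real^2) set \<Rightarrow> (real^2 \<Rightarrow> real^2) \<Rightarrow> real^2 \<Rightarrow> real^2^2" where
  "wjac D \<theta> x = (\<chi> i. wgrad D (\<lambda>y. \<theta> y $ i) x)"


section \<open>Sobolev spaces\<close>

definition H1 :: "(real^2) set \<Rightarrow> (real^2 \<Rightarrow> real) set" where
  "H1 D = {u. u \<in> L2 (lebesgue_on D) \<and> (\<exists>G. has_weak_grad D u G \<and> G \<in> L2 (lebesgue_on D))}"

definition H1_tendsto ::
    "(real^2) set \<Rightarrow> (nat \<Rightarrow> real^2 \<Rightarrow> real) \<Rightarrow> (real^2 \<Rightarrow> real) \<Rightarrow> bool"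
  \<comment> \<open>convergence in H1 of a sequence of smooth functions, whose gradients are classical\<close>
  where
  "H1_tendsto D \<phi> u \<longleftrightarrow> L2_tendsto (lebesgue_on D) \<phi> u \<and>
     L2_tendsto (lebesgue_on D) (\<lambda>n. grad (\<phi> n)) (wgrad D u)"

definition H10 :: "(real^2) set \<Rightarrow> (real^2 \<Rightarrow> real) set" where
  "H10 D = {u \<in> H1 D. \<exists>\<phi>. (\<forall>n. \<phi> n \<in> test_functions D) \<and> H1_tendsto D \<phi> u}"

definition Hdiv :: "(real^2) set \<Rightarrow> (real^2 \<Rightarrow> real^2) set" where
  "Hdiv D = {\<xi>. \<xi> \<in> L2 (lebesgue_on D) \<and> (\<exists>d. has_weak_div D \<xi> d \<and> d \<in> L2 (lebesgue_on D))}"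

definition W1inf :: "(real^2) set \<Rightarrow> (real^2 \<Rightarrow> real^2) set" where
  "W1inf D = {\<theta>. \<theta> \<in> Linf (lebesgue_on D) \<and>
     (\<forall>i. \<exists>G. has_weak_grad D (\<lambda>x. \<theta> x $ i) G \<and> G \<in> Linf (lebesgue_on D))}"


section \<open>Lipschitz boundaries, surface measure and traces\<close>

text \<open>Locally, up to an isometry, the set is the strict epigraph of a Lipschitz function.\<close>

definition lipschitz_boundary :: "(real^2) set \<Rightarrow> bool" where
  "lipschitz_boundary D \<longleftrightarrow> (\<forall>x\<in>frontier D. \<exists>Q \<gamma> L r.
     orthogonal_transformation (Q :: real^2 \<Rightarrow> real^2) \<and> L-lipschitz_on UNIV (\<gamma> :: real \<Rightarrow> real) \<and> r > 0 \<and>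
     D \<inter> ball x r = {y \<in> ball x r. \<gamma> (Q y $ 1) < Q y $ 2})"

definition hausdorff1_outer :: "(real^2) set \<Rightarrow> ennreal" where
  "hausdorff1_outer A = (SUP \<delta>\<in>{0<..}.
     INF C\<in>{C :: nat \<Rightarrow> (real^2) set. A \<subseteq> (\<Union>n. C n) \<and> (\<forall>n. bounded (C n) \<and> diameter (C n) \<le> \<delta>)}.
       \<Sum>n. ennreal (diameter (C n)))"

text \<open>
  Arc length on the boundary is the one-dimensional Hausdorff measure, which is a measure on
  the Borel sets because the outer measure is metric.
\<close>

definition surface :: "(real^2) set \<Rightarrow> (real^2) measure" where
  "surface D = restrict_space (measure_of UNIV (sets borel) hausdorff1_outer) (frontier D)"

definition has_trace :: "(real^2) set \<Rightarrow> (real^2 \<Rightarrow> real) \<Rightarrow> (real^2 \<Rightarrow> real) \<Rightarrow> bool"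
  \<comment> \<open>graph of the continuous extension to H1 of the restriction of smooth functions to the boundary\<close>
  where
  "has_trace D u w \<longleftrightarrow> u \<in> H1 D \<and> w \<in> L2 (surface D) \<and>
     (\<exists>\<phi>. (\<forall>n. smooth (\<phi> n)) \<and> H1_tendsto D \<phi> u \<and> L2_tendsto (surface D) \<phi> w)"

definition boundary_trace :: "(real^2) set \<Rightarrow> (real^2 \<Rightarrow> real) \<Rightarrow> real^2 \<Rightarrow> real" where
  "boundary_trace D u = (SOME w. has_trace D u w)"

text \<open>Sobolev--Slobodeckij space of order one half on the (one-dimensional) boundary.\<close>

definition H_half :: "(real^2) set \<Rightarrow> (real^2 \<Rightarrow> real) set" where
  "H_half D = {w \<in> L2 (surface D).
     (\<integral>\<^sup>+x. (\<integral>\<^sup>+y. ennreal ((w x - w y)\<^sup>2 / (dist x y)\<^sup>2) \<partial>surface D) \<partial>surface D) < \<infinity>}"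

text \<open>
  The normal component on the boundary of a field in \<^term>\<open>Hdiv D\<close> is in general not a function
  but a functional on the traces of \<^term>\<open>H1 D\<close>, defined through Green's formula.
\<close>

definition normal_trace :: "(real^2) set \<Rightarrow> (real^2 \<Rightarrow> real^2) \<Rightarrow> (real^2 \<Rightarrow> real) \<Rightarrow> real" where
  "normal_trace D \<xi> v = (LINT x|lebesgue_on D. \<xi> x \<bullet> wgrad D v x + wdiv D \<xi> x * v x)"

definition zero_normal_trace :: "(real^2) set \<Rightarrow> (real^2 \<Rightarrow> real^2) \<Rightarrow> bool" where
  "zero_normal_trace D \<xi> \<longleftrightarrow> (\<forall>v\<in>H1 D. normal_trace D \<xi> v = 0)"


section \<open>Finite Element spaces\<close>

definition ref_triangle :: "(real^2) set" where
  "ref_triangle = convex hull {0, axis 1 1, axis 2 1}"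

definition polys :: "nat \<Rightarrow> (real^2 \<Rightarrow> real) set" where
  "polys p = {q. \<exists>c. \<forall>x. q x = (\<Sum>i\<le>p. \<Sum>j\<le>p - i. c i j * (x $ 1) ^ i * (x $ 2) ^ j)}"

text \<open>
  A triangulation is given by the maps from the reference triangle onto its cells. Affine maps
  give straight triangles; bi-Lipschitz maps are allowed so that a domain which is not polygonal
  can be triangulated exactly, that is, with no error in the geometry. Distinct cells
  meet in a common proper face (possibly empty), which they parametrize in the same way up to an
  affine change of variable.
\<close>

definition triangulation :: "(real^2) set \<Rightarrow> (real^2 \<Rightarrow> real^2) set \<Rightarrow> bool" where
  "triangulation D \<T> \<longleftrightarrow> finite \<T> \<and> (\<Union>F\<in>\<T>. F ` ref_triangle) = closure D \<and>
     (\<forall>F\<in>\<T>. \<exists>c>0. \<exists>C. \<forall>x\<in>ref_triangle. \<forall>y\<in>ref_triangle.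
        c * dist x y \<le> dist (F x) (F y) \<and> dist (F x) (F y) \<le> C * dist x y) \<and>
     (\<forall>F\<in>\<T>. \<forall>F'\<in>\<T>. F \<noteq> F' \<longrightarrow>
        (\<exists>S S' A b. S face_of ref_triangle \<and> S \<noteq> ref_triangle \<and>
           S' face_of ref_triangle \<and> S' \<noteq> ref_triangle \<and>
           F ` ref_triangle \<inter> F' ` ref_triangle = F ` S \<and>
           linear A \<and> (\<lambda>x. A x + b) ` S = S' \<and> (\<forall>x\<in>S. F x = F' (A x + b))))"

definition lagrange_space ::
    "(real^2) set \<Rightarrow> (real^2 \<Rightarrow> real^2) set \<Rightarrow> nat \<Rightarrow> (real^2 \<Rightarrow> real) set" where
  "lagrange_space D \<T> p = {v. continuous_on (closure D) v \<and>
     (\<forall>F\<in>\<T>. \<exists>q\<in>polys p. \<forall>x\<in>ref_triangle. v (F x) = q x)}"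

definition lagrange_function :: "(real^2) set \<Rightarrow> (real^2 \<Rightarrow> real) \<Rightarrow> bool" where
  "lagrange_function D v \<longleftrightarrow> (\<exists>\<T> p. triangulation D \<T> \<and> p \<ge> 1 \<and> v \<in> lagrange_space D \<T> p)"

definition RT_polys :: "nat \<Rightarrow> (real^2 \<Rightarrow> real^2) set" where
  "RT_polys k = {q. \<exists>q0\<in>polys k. \<exists>q1\<in>polys k. \<exists>q2\<in>polys k.
     \<forall>x. q x = vector [q1 x, q2 x] + q0 x *\<^sub>R x}"

text \<open>
  On each cell a field is the contravariant Piola transform of one in the reference space; the
  continuity of normal components across edges is contained in membership in \<^term>\<open>Hdiv D\<close>.
\<close>

definition RT_space ::
    "(real^2) set \<Rightarrow> (real^2 \<Rightarrow> real^2) set \<Rightarrow> nat \<Rightarrow> (real^2 \<Rightarrow> real^2) set" where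
  "RT_space D \<T> k = {\<xi> \<in> Hdiv D. \<forall>F\<in>\<T>. \<exists>q\<in>RT_polys k. AE x in lebesgue_on ref_triangle.
     \<exists>F'. (F has_derivative F') (at x) \<and> \<xi> (F x) = (1 / det (matrix F')) *\<^sub>R F' (q x)}"


section \<open>State, adjoint and flux problems\<close>

datatype bdry = Neumann | Dirichlet

primrec space_V :: "(real^2) set \<Rightarrow> bdry \<Rightarrow> (real^2 \<Rightarrow> real) set" where
  "space_V D Neumann = H1 D"
| "space_V D Dirichlet = H10 D"

definition space_Vh ::
    "(real^2) set \<Rightarrow> (real^2 \<Rightarrow> real^2) set \<Rightarrow> nat \<Rightarrow> bdry \<Rightarrow> (real^2 \<Rightarrow> real) set" where
  "space_Vh D \<T> p i = space_V D i \<inter> lagrange_space D \<T> p"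

definition space_Sigma_h ::
    "(real^2) set \<Rightarrow> (real^2 \<Rightarrow> real^2) set \<Rightarrow> nat \<Rightarrow> bdry \<Rightarrow> (real^2 \<Rightarrow> real^2) set" where
  "space_Sigma_h D \<T> k i = {\<xi> \<in> RT_space D \<T> k. i = Neumann \<longrightarrow> zero_normal_trace D \<xi>}"

definition conductivity :: "real \<Rightarrow> real \<Rightarrow> (real^2) set \<Rightarrow> real^2 \<Rightarrow> real" where
  "conductivity kI kE \<Omega> x = kI * indicator \<Omega> x + kE * (1 - indicator \<Omega> x)"

text \<open>In the following, \<^term>\<open>k :: real^2 \<Rightarrow> real\<close> is the conductivity.\<close>

definition form_a ::
    "(real^2) set \<Rightarrow> (real^2 \<Rightarrow> real) \<Rightarrow> (real^2 \<Rightarrow> real) \<Rightarrow> (real^2 \<Rightarrow> real) \<Rightarrow> real" where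
  "form_a D k u v =
     (LINT x|lebesgue_on D. k x * (wgrad D u x \<bullet> wgrad D v x) + u x * v x)"

definition energy_norm :: "(real^2) set \<Rightarrow> (real^2 \<Rightarrow> real) \<Rightarrow> (real^2 \<Rightarrow> real) \<Rightarrow> real" where
  "energy_norm D k v = sqrt (form_a D k v v)"

primrec load :: "(real^2) set \<Rightarrow> (real^2 \<Rightarrow> real) \<Rightarrow> bdry \<Rightarrow> (real^2 \<Rightarrow> real) \<Rightarrow> real" where
  "load D g Neumann v = (LINT x|surface D. g x * boundary_trace D v x)"
| "load D g Dirichlet v = 0"

definition M_mat :: "(real^2) set \<Rightarrow> (real^2 \<Rightarrow> real^2) \<Rightarrow> real^2 \<Rightarrow> real^2^2" where
  "M_mat D \<theta> x = wjac D \<theta> x + transpose (wjac D \<theta> x) - wdiv D \<theta> x *\<^sub>R mat 1"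

definition adjoint_rhs ::
    "(real^2) set \<Rightarrow> (real^2 \<Rightarrow> real) \<Rightarrow> (real^2 \<Rightarrow> real^2) \<Rightarrow> (real^2 \<Rightarrow> real) \<Rightarrow> (real^2 \<Rightarrow> real) \<Rightarrow> real"
  \<comment> \<open>derivative in direction v of half the integral of
      k M(\<theta>) \<nabla>u \<bullet> \<nabla>u - (div \<theta>) u^2 with respect to u\<close>
  where
  "adjoint_rhs D k \<theta> u v = (LINT x|lebesgue_on D.
     k x * ((M_mat D \<theta> x *v wgrad D u x) \<bullet> wgrad D v x) - wdiv D \<theta> x * u x * v x)"

definition discrete_state ::
    "(real^2) set \<Rightarrow> (real^2 \<Rightarrow> real) \<Rightarrow> (real^2 \<Rightarrow> real) \<Rightarrow> (real^2 \<Rightarrow> real) \<Rightarrow>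
     (real^2 \<Rightarrow> real^2) set \<Rightarrow> nat \<Rightarrow> bdry \<Rightarrow> (real^2 \<Rightarrow> real) \<Rightarrow> bool" where
  "discrete_state D k g U\<^sub>D \<T> p i u \<longleftrightarrow> u \<in> H1 D \<and> lagrange_function D u \<and>
     (i = Neumann \<longrightarrow> u \<in> space_Vh D \<T> p Neumann) \<and> (i = Dirichlet \<longrightarrow> has_trace D u U\<^sub>D) \<and>
     (\<forall>v\<in>space_Vh D \<T> p i. form_a D k u v = load D g i v)"

definition discrete_flux ::
    "(real^2) set \<Rightarrow> (real^2 \<Rightarrow> real) \<Rightarrow> (real^2 \<Rightarrow> real^2) \<Rightarrow> (real^2 \<Rightarrow> real) \<Rightarrow>
     (real^2 \<Rightarrow> real^2) set \<Rightarrow> nat \<Rightarrow> bdry \<Rightarrow> (real^2 \<Rightarrow> real^2) \<Rightarrow> bool" where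
  "discrete_flux D k \<theta> u \<T> m i \<xi> \<longleftrightarrow> \<xi> \<in> space_Sigma_h D \<T> m i \<and>
     (\<forall>\<eta>\<in>space_Sigma_h D \<T> m i.
        (LINT x|lebesgue_on D. inverse (k x) * (\<xi> x \<bullet> \<eta> x) + wdiv D \<xi> x * wdiv D \<eta> x) =
        (LINT x|lebesgue_on D. wdiv D \<theta> x * u x * wdiv D \<eta> x - (M_mat D \<theta> x *v wgrad D u x) \<bullet> \<eta> x))"

end

theory Submission
  imports Defs
begin

text \<open>
  The estimate is an instance of the Prager--Synge (hypercircle) argument. The error
  \<open>e = r - r\<^sub>h\<close> belongs to the space of test functions of the adjoint problem, so testing with
  \<open>v = e\<close> gives \<open>a(e, e) = H(e) - a(e, r\<^sub>h)\<close>. Every admissible flux satisfies Green's formula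
  without boundary term, \<open>\<integral> \<xi> \<bullet> \<nabla>e + (div \<xi>) e = 0\<close>: for Neumann conditions because its normal
  trace vanishes, for Dirichlet conditions because \<open>e\<close> is an H1 limit of test functions
  (\<open>normal_trace_H10\<close>). Adding this zero turns the error identity into
  \<open>a(e, e) = \<integral> A \<bullet> \<nabla>e + B e\<close>, where \<open>A\<close> and \<open>B\<close> are precisely the two residuals
  of the claim, and Young's inequality with weight \<open>k\<close> absorbs half of \<open>a(e, e)\<close> on the
  left (\<open>weighted_energy_bound\<close>).

  The analytic content is that all these integrals exist and that
  \<open>\<nabla>e = \<nabla>r - \<nabla>r\<^sub>h\<close>. As weak derivatives are arbitrary choices among functions satisfying the
  integration by parts identity, both facts rest on their uniqueness almost everywhere, that
  is, on the fundamental lemma of the calculus of variations (\<open>fundamental_lemma\<close>). It is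
  proved with explicit bump functions built from \<open>exp (-1/t)\<close>, which converge to the
  indicators of boxes.
\<close>

section \<open>Calculus of smooth functions on the plane\<close>

lemma grad_component:
  assumes "(f has_derivative f') (at x)"
  shows "grad f x $ j = f' (axis j 1)"
  using frechet_derivative_at[OF assms] by (simp add: grad_def)

lemma C_k_SucI:
  assumes "\<And>x. (f has_derivative f' x) (at x)" "\<And>j. C_k k (\<lambda>x. f' x (axis j 1))"
  shows "C_k (Suc k) f"
  using assms by (auto simp: grad_component[OF assms(1)] differentiable_def)

lemma C_k_Suc_has_derivative:
  assumes "C_k (Suc k) f"
  shows "(f has_derivative frechet_derivative f (at x)) (at x)"
  using assms frechet_derivative_works by auto

lemma C_k_Suc_component:
  assumes "C_k (Suc k) f"
  shows "C_k k (\<lambda>x. frechet_derivative f (at x) (axis j 1))"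
  using assms by (auto simp: grad_def)

lemma C_k_Suc_imp: "C_k (Suc k) f \<Longrightarrow> C_k k f"
proof (induction k arbitrary: f)
  case 0
  then show ?case
    by (simp add: differentiable_imp_continuous_within continuous_at_imp_continuous_on)
next
  case (Suc k)
  then show ?case
    by (metis C_k.simps(2))
qed

lemma C_k_const: "C_k k (\<lambda>x. c)"
proof (induction k arbitrary: c)
  case (Suc k)
  show ?case by (rule C_k_SucI[where f' = "\<lambda>_ _. 0"]) (use Suc in auto)
qed auto

lemma C_k_add: "C_k k f \<Longrightarrow> C_k k g \<Longrightarrow> C_k k (\<lambda>x. f x + g x)"
proof (induction k arbitrary: f g)
  case (Suc k)
  note d = C_k_Suc_has_derivative[OF Suc.prems(1)] C_k_Suc_has_derivative[OF Suc.prems(2)]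
  show ?case
    by (rule C_k_SucI[OF has_derivative_add[OF d]])
      (intro Suc.IH C_k_Suc_component[OF Suc.prems(1)] C_k_Suc_component[OF Suc.prems(2)])
qed (simp add: continuous_on_add)

lemma C_k_mult: "C_k k f \<Longrightarrow> C_k k g \<Longrightarrow> C_k k (\<lambda>x. f x * g x)"
proof (induction k arbitrary: f g)
  case (Suc k)
  note d = C_k_Suc_has_derivative[OF Suc.prems(1)] C_k_Suc_has_derivative[OF Suc.prems(2)]
  show ?case
    by (rule C_k_SucI[OF has_derivative_mult[OF d]])
      (intro C_k_add Suc.IH C_k_Suc_component[OF Suc.prems(1)] C_k_Suc_component[OF Suc.prems(2)]
        C_k_Suc_imp[OF Suc.prems(1)] C_k_Suc_imp[OF Suc.prems(2)])
qed (simp add: continuous_on_mult)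

lemma smooth_const: "smooth (\<lambda>x. c)"
  by (simp add: smooth_def C_k_const)

lemma smooth_mult: "smooth f \<Longrightarrow> smooth g \<Longrightarrow> smooth (\<lambda>x. f x * g x)"
  by (simp add: smooth_def C_k_mult)

lemma smooth_diff: "smooth f \<Longrightarrow> smooth g \<Longrightarrow> smooth (\<lambda>x. f x - g x)"
  using C_k_add[of _ f "\<lambda>x. (-1) * g x"] C_k_mult[OF C_k_const[of _ "-1"], of _ g]
  by (simp add: smooth_def)

lemma smooth_prod:
  "finite J \<Longrightarrow> (\<And>j. j \<in> J \<Longrightarrow> smooth (f j)) \<Longrightarrow> smooth (\<lambda>x. \<Prod>j\<in>J. f j x)"
  by (induction J rule: finite_induct) (auto intro: smooth_const smooth_mult)

lemma smooth_has_derivative: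
  "smooth f \<Longrightarrow> (f has_derivative frechet_derivative f (at x)) (at x)"
  unfolding smooth_def by (rule C_k_Suc_has_derivative) (rule spec)

lemma smooth_continuous: "smooth f \<Longrightarrow> continuous_on UNIV f"
  unfolding smooth_def by (metis C_k.simps(1))

lemma smooth_continuous_grad: "smooth f \<Longrightarrow> continuous_on UNIV (\<lambda>x. grad f x $ j)"
  unfolding smooth_def by (metis C_k.simps)

lemma grad_diff:
  assumes "smooth f" "smooth g"
  shows "grad (\<lambda>x. f x - g x) x = grad f x - grad g x"
proof -
  have "((\<lambda>x. f x - g x) has_derivative
      (\<lambda>h. frechet_derivative f (at x) h - frechet_derivative g (at x) h)) (at x)"
    by (intro has_derivative_diff smooth_has_derivative assms)
  then show ?thesis
    by (simp add: vec_eq_iff grad_component) (simp add: grad_def)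
qed

lemma grad_zero_outside:
  assumes "x \<notin> closure {x. f x \<noteq> 0}"
  shows "grad f x = 0"
proof -
  have "((\<lambda>x. 0) has_derivative (\<lambda>_. 0)) (at x)" by simp
  then have "(f has_derivative (\<lambda>_. 0)) (at x)"
    by (rule has_derivative_transform_within_open[where s = "- closure {x. f x \<noteq> 0}"])
      (use assms closure_subset[of "{x. f x \<noteq> 0}"] in auto)
  then show ?thesis by (simp add: vec_eq_iff grad_component)
qed

text \<open>
  The extension of \<open>exp (-1/t)\<close> by zero is the case \<open>m = 0\<close>. The powers are there because the linear
  span of the family is closed under differentiation, so that smoothness follows by induction on the
  order with \<open>m\<close> arbitrary.
\<close>

definition flat :: "nat \<Rightarrow> real \<Rightarrow> real" where
  "flat m t = (if t > 0 then (1 / t) ^ m * exp (- (1 / t)) else 0)"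

lemma flat_tendsto_0: "(flat m \<longlongrightarrow> 0) (at_right 0)"
proof -
  have "((\<lambda>t. (inverse t) ^ m / exp (inverse t)) \<longlongrightarrow> (0::real)) (at_right 0)"
    by (rule filterlim_compose[OF tendsto_power_div_exp_0 filterlim_inverse_at_top_right])
  then show ?thesis
    by (rule Lim_transform_eventually)
      (auto simp: eventually_at_filter flat_def exp_minus field_simps)
qed

text \<open>
  At the origin the difference quotient \<open>flat m t / t\<close> is \<open>flat (m + 1) t\<close> for \<open>t > 0\<close>, which tends to
  zero because the exponential beats every power.
\<close>

lemma flat_has_derivative:
  "(flat m has_real_derivative flat (m + 2) t - m * flat (m + 1) t) (at t)"
proof (cases t "0::real" rule: linorder_cases)
  case less
  have "((\<lambda>t. 0) has_real_derivative 0) (at t)" by simp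
  then have "(flat m has_real_derivative 0) (at t)"
    by (rule has_field_derivative_transform_within_open[where S = "{..<0}"])
      (use less in \<open>auto simp: flat_def\<close>)
  then show ?thesis using less by (simp add: flat_def)
next
  case greater
  have s: "((\<lambda>t. 1 / t) has_real_derivative - ((1 / t)\<^sup>2)) (at t)"
    using DERIV_inverse[of t] greater by (simp add: inverse_eq_divide power2_eq_square)
  have p: "((\<lambda>t. (1 / t) ^ m) has_real_derivative - (m * (1 / t) ^ (m + 1))) (at t)"
  proof (cases m)
    case (Suc n)
    show ?thesis
      using DERIV_power[OF s, of m] by (simp add: Suc power2_eq_square algebra_simps)
  qed simp
  have e: "((\<lambda>t. exp (- (1 / t))) has_real_derivative exp (- (1 / t)) * (1 / t)\<^sup>2) (at t)"
    using DERIV_fun_exp[OF DERIV_minus[OF s]] by simp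
  have "((\<lambda>t. (1 / t) ^ m * exp (- (1 / t))) has_real_derivative
      flat (m + 2) t - m * flat (m + 1) t) (at t)"
    using DERIV_mult[OF p e] greater
    by (simp only: flat_def if_True)
      (simp add: power_add power2_eq_square algebra_simps)
  then show ?thesis
    by (rule has_field_derivative_transform_within_open[where S = "{0<..}"])
      (use greater in \<open>auto simp: flat_def\<close>)
next
  case equal
  have "((\<lambda>h. flat m h / h) \<longlongrightarrow> 0) (at 0)"
  proof (rule filterlim_split_at)
    have "\<forall>\<^sub>F h in at_left 0. flat m h / h = 0"
      by (auto simp: eventually_at_filter flat_def)
    then show "((\<lambda>h. flat m h / h) \<longlongrightarrow> 0) (at_left 0)"
      by (rule tendsto_eventually)
    have "\<forall>\<^sub>F h in at_right 0. flat (Suc m) h = flat m h / h"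
      by (auto simp: eventually_at_filter flat_def)
    then show "((\<lambda>h. flat m h / h) \<longlongrightarrow> 0) (at_right 0)"
      by (rule Lim_transform_eventually[OF flat_tendsto_0])
  qed
  then show ?thesis
    using equal by (simp add: DERIV_def flat_def[of _ 0])
qed

lemma smooth_flat: "smooth (\<lambda>x. flat m (c * x $ i + d))"
proof -
  have "C_k k (\<lambda>x. flat m (c * x $ i + d))" for k
  proof (induction k arbitrary: m)
    case 0
    have "isCont (flat m) t" for t
      by (rule DERIV_isCont[OF flat_has_derivative])
    then have "continuous_on UNIV (flat m)"
      by (simp add: continuous_at_imp_continuous_on)
    then have "continuous_on UNIV (\<lambda>x :: real^2. flat m (c * x $ i + d))"
      by (rule continuous_on_compose2) (auto intro!: continuous_intros)
    then show ?case by simp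
  next
    case (Suc k)
    have inner: "((\<lambda>x :: real^2. c * x $ i + d) has_derivative (\<lambda>h. c * h $ i)) (at x)" for x
      using has_derivative_add[OF has_derivative_mult_right[OF
          bounded_linear_imp_has_derivative[OF bounded_linear_vec_nth]] has_derivative_const]
      by simp
    let ?D = "\<lambda>t. flat (m + 2) t - m * flat (m + 1) t"
    have der: "((\<lambda>x :: real^2. flat m (c * x $ i + d)) has_derivative
        (\<lambda>h. ?D (c * x $ i + d) * (c * h $ i))) (at x)" for x
      using has_derivative_compose[OF inner flat_has_derivative[unfolded has_field_derivative_def]]
      by simp
    have "C_k k (\<lambda>x. (flat (m + 2) (c * x $ i + d) + (- m) * flat (m + 1) (c * x $ i + d)) * b)" for b
      by (intro C_k_mult C_k_add C_k_const Suc.IH)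
    from this[of "c * axis _ 1 $ i"] show ?case
      by (intro C_k_SucI[OF der]) simp
  qed
  then show ?thesis by (simp add: smooth_def)
qed

text \<open>
  The factor \<open>c\<close> sharpens the bump: for fixed \<open>x\<close> in the open box all arguments grow with \<open>c\<close>, and
  \<open>flat 0\<close> tends to one at infinity.
\<close>

definition bump :: "real \<Rightarrow> real^2 \<Rightarrow> real^2 \<Rightarrow> real^2 \<Rightarrow> real" where
  "bump c a b x = (\<Prod>j\<in>UNIV. flat 0 (c * (x $ j - a $ j)) * flat 0 (c * (b $ j - x $ j)))"

lemma smooth_bump: "smooth (bump c a b)"
proof -
  have 1: "smooth (\<lambda>x. flat 0 (c * (x $ j - a $ j)))" for j
    using smooth_flat[of 0 c j "- (c * a $ j)"] by (simp add: algebra_simps)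
  have 2: "smooth (\<lambda>x. flat 0 (c * (b $ j - x $ j)))" for j
    using smooth_flat[of 0 "- c" j "c * b $ j"] by (simp add: algebra_simps)
  have "smooth (\<lambda>x. \<Prod>j\<in>UNIV. flat 0 (c * (x $ j - a $ j)) * flat 0 (c * (b $ j - x $ j)))"
    by (intro smooth_prod smooth_mult 1 2) simp
  then show ?thesis by (simp add: bump_def[abs_def])
qed

lemma flat_0_bounds: "0 \<le> flat 0 t" "flat 0 t \<le> 1"
  by (auto simp: flat_def)

lemma bump_nonneg: "0 \<le> bump c a b x"
  by (auto simp: bump_def intro!: prod_nonneg mult_nonneg_nonneg flat_0_bounds)

lemma bump_le_1: "bump c a b x \<le> 1"
  unfolding bump_def
  by (rule prod_le_1) (auto intro!: mult_le_one mult_nonneg_nonneg flat_0_bounds)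

lemma bump_pos_iff:
  assumes "c > 0"
  shows "bump c a b x \<noteq> 0 \<longleftrightarrow> x \<in> box a b"
  using assms by (auto simp: bump_def flat_def mem_box_cart zero_less_mult_iff)

lemma bump_tendsto_indicator: "(\<lambda>n. bump (real n + 1) a b x) \<longlonglongrightarrow> indicator (box a b) x"
proof (cases "x \<in> box a b")
  case True
  have lim: "(\<lambda>n. flat 0 ((real n + 1) * t)) \<longlonglongrightarrow> 1" if "t > 0" for t
  proof -
    have "(\<lambda>n. exp (- ((1 / t) * (1 / real (Suc n))))) \<longlonglongrightarrow> exp (- ((1 / t) * 0))"
      by (intro tendsto_intros LIMSEQ_Suc lim_1_over_n)
    then show ?thesis
      using that by (simp add: flat_def add.commute mult.commute)
  qed
  have "(\<lambda>n. bump (real n + 1) a b x) \<longlonglongrightarrow> (\<Prod>j\<in>(UNIV::2 set). 1 * 1)"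
    unfolding bump_def
    by (intro tendsto_intros lim) (use True in \<open>auto simp: mem_box_cart\<close>)
  then show ?thesis using True by simp
next
  case False
  then have "bump (real n + 1) a b x = 0" for n
    using bump_pos_iff[of "real n + 1" a b x] by auto
  then show ?thesis using False by simp
qed

lemma test_functionsD:
  assumes "\<phi> \<in> test_functions D"
  shows "smooth \<phi>" "compact (closure {x. \<phi> x \<noteq> 0})" "closure {x. \<phi> x \<noteq> 0} \<subseteq> D"
    "x \<notin> closure {x. \<phi> x \<noteq> 0} \<Longrightarrow> \<phi> x = 0"
  using assms closure_subset[of "{x. \<phi> x \<noteq> 0}"] by (auto simp: test_functions_def)

lemma test_functionsI:
  assumes "smooth \<phi>" "compact K" "K \<subseteq> D" "\<And>x. x \<notin> K \<Longrightarrow> \<phi> x = 0"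
  shows "\<phi> \<in> test_functions D"
proof -
  have "closure {x. \<phi> x \<noteq> 0} \<subseteq> K"
    using assms by (intro closure_minimal compact_imp_closed) auto
  moreover from this have "compact (closure {x. \<phi> x \<noteq> 0})"
    using \<open>compact K\<close> by (metis closed_closure compact_Int_closed inf.absorb_iff2)
  ultimately show ?thesis
    using assms by (auto simp: test_functions_def)
qed

lemma test_functions_mult:
  assumes "\<phi> \<in> test_functions D" "smooth \<psi>"
  shows "(\<lambda>x. \<phi> x * \<psi> x) \<in> test_functions D"
  using smooth_mult[OF test_functionsD(1)[OF assms(1)] assms(2)] test_functionsD(2-3)[OF assms(1)]
  by (rule test_functionsI) (metis mult_zero_left test_functionsD(4)[OF assms(1)])

lemma test_functions_diff:
  assumes "\<phi> \<in> test_functions D" "\<psi> \<in> test_functions D"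
  shows "(\<lambda>x. \<phi> x - \<psi> x) \<in> test_functions D"
proof (rule test_functionsI)
  show "smooth (\<lambda>x. \<phi> x - \<psi> x)"
    by (intro smooth_diff test_functionsD(1)[OF assms(1)] test_functionsD(1)[OF assms(2)])
  show "compact (closure {x. \<phi> x \<noteq> 0} \<union> closure {x. \<psi> x \<noteq> 0})"
    by (intro compact_Un test_functionsD(2)[OF assms(1)] test_functionsD(2)[OF assms(2)])
  show "closure {x. \<phi> x \<noteq> 0} \<union> closure {x. \<psi> x \<noteq> 0} \<subseteq> D"
    using test_functionsD(3)[OF assms(1)] test_functionsD(3)[OF assms(2)] by simp
qed (metis Un_iff diff_self test_functionsD(4)[OF assms(1)] test_functionsD(4)[OF assms(2)])

lemma bump_test_function:
  assumes "c > 0" "cbox a b \<subseteq> D"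
  shows "bump c a b \<in> test_functions D"
  using smooth_bump compact_cbox assms(2)
  by (rule test_functionsI) (metis assms(1) bump_pos_iff box_subset_cbox subsetD)

section \<open>The fundamental lemma of the calculus of variations\<close>

text \<open>
  Boxes form an intersection-stable generator of the Borel sets, so the integrals vanish over all Borel
  sets; \<open>total\<close> serves the complement step of this argument. A Lebesgue measurable set differs
  from a Borel set by a null set.
\<close>

lemma AE_zero_if_box_integrals_zero:
  fixes F :: "'a::euclidean_space \<Rightarrow> real"
  assumes F: "integrable lebesgue F" and total: "integral\<^sup>L lebesgue F = 0"
    and boxes: "\<And>a b. (LINT x:box a b|lebesgue. F x) = 0"
  shows "AE x in lebesgue. F x = 0"
proof (rule density_unique_real[OF F integrable_zero])
  have set_int: "set_integrable lebesgue A F" if "A \<in> sets lebesgue" for A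
    using integrable_mult_indicator[OF that F] by (simp add: set_integrable_def)
  have sets_borel: "sets (borel :: 'a measure) = sigma_sets UNIV (range (\<lambda>(a, b). box a b))"
    by (subst borel_eq_box) simp
  have borel: "(LINT x:A|lebesgue. F x) = 0"
    if "A \<in> sigma_sets UNIV (range (\<lambda>(a, b). box a b :: 'a set))" for A
  proof -
    have sets: "B \<in> sets lebesgue"
      if "B \<in> sigma_sets UNIV (range (\<lambda>(a, b). box a b :: 'a set))" for B
      using that unfolding sets_borel[symmetric] by simp
    have "Int_stable (range (\<lambda>(a, b). box a b :: 'a set))"
      by (auto simp: Int_stable_def box_Int_box)
    moreover have "range (\<lambda>(a, b). box a b :: 'a set) \<subseteq> Pow UNIV" by simp
    ultimately show ?thesis
      using that
    proof (induction rule: sigma_sets_induct_disjoint)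
      case (basic A)
      then show ?case using boxes by auto
    next
      case empty
      then show ?case by (simp add: set_lebesgue_integral_def)
    next
      case (compl A)
      have "(LINT x:(A \<union> (UNIV - A))|lebesgue. F x) =
          (LINT x:A|lebesgue. F x) + (LINT x:(UNIV - A)|lebesgue. F x)"
        using sets[OF compl(1)] by (intro set_integral_Un set_int) auto
      moreover have "A \<union> (UNIV - A) = UNIV" by auto
      ultimately show ?case
        using compl(2) total by (simp add: set_lebesgue_integral_def)
    next
      case (union A)
      have A: "A i \<in> sets lebesgue" for i
        using union(2) by (intro sets) auto
      have "(LINT x:(\<Union>i. A i)|lebesgue. F x) = (\<Sum>i. (LINT x:(A i)|lebesgue. F x))"
        using union(1) A
        by (intro lebesgue_integral_countable_add set_int sets.countable_UN)
          (auto simp: disjoint_family_on_def)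
      then show ?case using union(3) by simp
    qed
  qed
  fix A :: "'a set" assume A: "A \<in> sets lebesgue"
  have "AE x in lebesgue. x \<notin> null_part lborel A"
    using A null_part_null_sets by (intro AE_not_in) auto
  then have "AE x in lebesgue. x \<in> A \<longleftrightarrow> x \<in> main_part lborel A"
    by eventually_elim (metis A Un_iff main_part_null_part_Un)
  then have eq: "AE x in lebesgue. indicator A x *\<^sub>R F x = indicator (main_part lborel A) x *\<^sub>R F x"
    by eventually_elim (simp add: indicator_def)
  have main: "main_part lborel A \<in> sets lborel"
    using A by (rule main_part_sets)
  then have "(LINT x:A|lebesgue. F x) = (LINT x:main_part lborel A|lebesgue. F x)"
    unfolding set_lebesgue_integral_def using A borel_measurable_integrable[OF F]
    by (intro integral_cong_AE eq borel_measurable_scaleR borel_measurable_indicator) auto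
  also have "\<dots> = 0"
    using main by (intro borel) (simp add: sets_borel)
  finally show "(LINT x:A|lebesgue. F x) = (LINT x:A|lebesgue. 0)"
    by (simp add: set_lebesgue_integral_def)
qed

lemma integrable_compact_support:
  fixes f :: "real^2 \<Rightarrow> real"
  assumes "open D" "locally_integrable D f" "continuous_on UNIV \<phi>" "compact K" "K \<subseteq> D"
    and zero: "\<And>x. x \<notin> K \<Longrightarrow> \<phi> x = 0"
  shows "integrable (lebesgue_on D) (\<lambda>x. f x * \<phi> x)"
proof -
  have K: "K \<in> sets lebesgue" and D: "D \<in> sets lebesgue"
    using assms by (auto simp: borel_compact borel_open)
  have \<phi>: "continuous_on K \<phi>"
    using assms continuous_on_subset by blast
  have "bounded (\<phi> ` K)"
    using \<phi> \<open>compact K\<close> compact_continuous_image compact_imp_bounded by blast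
  then have "(\<lambda>x. \<phi> x * f x) absolutely_integrable_on K"
    using assms K continuous_imp_measurable_on_sets_lebesgue[OF \<phi> K]
    by (intro absolutely_integrable_bounded_measurable_product[OF bilinear_times])
      (auto simp: locally_integrable_def)
  then have "integrable lebesgue (\<lambda>x. indicator K x *\<^sub>R (\<phi> x * f x))"
    by (simp add: set_integrable_def)
  moreover have "(\<lambda>x. indicator K x *\<^sub>R (\<phi> x * f x)) = (\<lambda>x. if x \<in> D then f x * \<phi> x else 0)"
    using \<open>K \<subseteq> D\<close> zero by (fastforce simp: indicator_def)
  ultimately show ?thesis
    using Lebesgue_Measure.integrable_restrict_UNIV[OF D, of "\<lambda>x. f x * \<phi> x"] by simp
qed

lemma integrable_test_function:
  fixes f :: "real^2 \<Rightarrow> real"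
  assumes "open D" "locally_integrable D f" "\<phi> \<in> test_functions D"
  shows "integrable (lebesgue_on D) (\<lambda>x. f x * \<phi> x)"
    and "integrable (lebesgue_on D) (\<lambda>x. f x * grad \<phi> x $ j)"
proof -
  note \<phi> = test_functionsD[OF assms(3)]
  show "integrable (lebesgue_on D) (\<lambda>x. f x * \<phi> x)"
    by (rule integrable_compact_support[OF assms(1,2) smooth_continuous[OF \<phi>(1)] \<phi>(2,3,4)])
  show "integrable (lebesgue_on D) (\<lambda>x. f x * grad \<phi> x $ j)"
    by (rule integrable_compact_support[OF assms(1,2) smooth_continuous_grad[OF \<phi>(1)] \<phi>(2,3)])
      (simp add: grad_zero_outside)
qed

text \<open>
  Multiplication by a bump \<open>\<psi>\<close> on the box makes \<open>f\<close> integrable over the whole plane, and products of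
  \<open>\<psi>\<close> with further bumps remain test functions. Hence the integrals of \<open>f \<psi>\<close> over arbitrary
  boxes vanish by dominated convergence, and \<open>\<psi>\<close> has no zero in the box.
\<close>

lemma fundamental_lemma_box:
  fixes f :: "real^2 \<Rightarrow> real"
  assumes "open D" "locally_integrable D f" "cbox a b \<subseteq> D"
    and zero: "\<And>\<phi>. \<phi> \<in> test_functions D \<Longrightarrow> (LINT x|lebesgue_on D. f x * \<phi> x) = 0"
  shows "AE x in lebesgue. x \<in> box a b \<longrightarrow> f x = 0"
proof -
  let ?\<psi> = "bump 1 a b"
  define F where "F = (\<lambda>x. if x \<in> D then f x * ?\<psi> x else 0)"
  have D: "D \<in> sets lebesgue" using assms(1) by (simp add: borel_open)
  have \<psi>: "?\<psi> \<in> test_functions D" using assms(3) by (intro bump_test_function) auto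
  have F: "integrable lebesgue F"
    unfolding F_def using integrable_test_function(1)[OF assms(1,2) \<psi>]
    by (subst Lebesgue_Measure.integrable_restrict_UNIV[OF D])
  have meas: "bump c u v \<in> borel_measurable lebesgue" for c u v
    using continuous_imp_measurable_on_sets_lebesgue[OF smooth_continuous[OF smooth_bump], of c u v]
    by (simp add: lebesgue_on_UNIV_eq)
  have "AE x in lebesgue. F x = 0"
  proof (rule AE_zero_if_box_integrals_zero[OF F])
    show "integral\<^sup>L lebesgue F = 0"
      unfolding F_def using zero[OF \<psi>] by (simp add: Lebesgue_Measure.integral_restrict_UNIV[OF D])
  next
    fix u v :: "real^2"
    have "(\<lambda>n. LINT x|lebesgue. bump (real n + 1) u v x *\<^sub>R F x)
        \<longlonglongrightarrow> (LINT x|lebesgue. indicator (box u v) x *\<^sub>R F x)"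
    proof (rule integral_dominated_convergence[where w = "\<lambda>x. norm (F x)"])
      show "AE x in lebesgue. (\<lambda>n. bump (real n + 1) u v x *\<^sub>R F x)
          \<longlonglongrightarrow> indicator (box u v) x *\<^sub>R F x"
        by (intro AE_I2 tendsto_intros bump_tendsto_indicator)
      show "AE x in lebesgue. norm (bump (real n + 1) u v x *\<^sub>R F x) \<le> norm (F x)" for n
        using bump_nonneg bump_le_1 by (intro AE_I2) (auto intro!: mult_left_le_one_le simp: abs_mult)
      show "integrable lebesgue (\<lambda>x. norm (F x))" using F by simp
    qed (use borel_measurable_integrable[OF F] meas in
        \<open>auto intro!: borel_measurable_scaleR borel_measurable_times borel_measurable_indicator\<close>)
    moreover have "(LINT x|lebesgue. bump (real n + 1) u v x *\<^sub>R F x) = 0" for n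
    proof -
      have "(LINT x|lebesgue. bump (real n + 1) u v x *\<^sub>R F x) =
          (LINT x|lebesgue. (if x \<in> D then f x * (?\<psi> x * bump (real n + 1) u v x) else 0))"
        by (intro Bochner_Integration.integral_cong) (auto simp: F_def)
      also have "\<dots> = (LINT x|lebesgue_on D. f x * (?\<psi> x * bump (real n + 1) u v x))"
        by (rule Lebesgue_Measure.integral_restrict_UNIV[OF D])
      also have "\<dots> = 0"
        by (intro zero test_functions_mult \<psi> smooth_bump)
      finally show ?thesis .
    qed
    ultimately show "(LINT x:box u v|lebesgue. F x) = 0"
      by (simp add: set_lebesgue_integral_def LIMSEQ_const_iff)
  qed
  then show ?thesis
  proof eventually_elim
    case (elim x)
    then show ?case
      using bump_pos_iff[of 1 a b x] assms(3) box_subset_cbox[of a b] by (auto simp: F_def)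
  qed
qed

lemma AE_lebesgue_on_iff:
  assumes "D \<in> sets lebesgue"
  shows "(AE x in lebesgue_on D. P x) \<longleftrightarrow> (AE x in lebesgue. x \<in> D \<longrightarrow> P x)"
  using AE_restrict_space_iff[of D lebesgue P] assms by simp

lemma fundamental_lemma:
  fixes f :: "real^2 \<Rightarrow> real"
  assumes "open D" "locally_integrable D f"
    and zero: "\<And>\<phi>. \<phi> \<in> test_functions D \<Longrightarrow> (LINT x|lebesgue_on D. f x * \<phi> x) = 0"
  shows "AE x in lebesgue_on D. f x = 0"
proof -
  define \<F> where "\<F> = {box a b | a b. cbox a b \<subseteq> D}"
  have "\<And>B. B \<in> \<F> \<Longrightarrow> open B" by (auto simp: \<F>_def open_box)
  then obtain \<B> where \<B>: "\<B> \<subseteq> \<F>" "countable \<B>" "\<Union>\<B> = \<Union>\<F>"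
    by (rule Lindelof)
  have "D \<subseteq> \<Union>\<F>"
  proof
    fix x assume "x \<in> D"
    then obtain a b where "cbox a b \<subseteq> D" "x \<in> box a b"
      using open_contains_cbox[OF assms(1)] by metis
    then show "x \<in> \<Union>\<F>" by (auto simp: \<F>_def)
  qed
  have "AE x in lebesgue. \<forall>B\<in>\<B>. x \<in> B \<longrightarrow> f x = 0"
    unfolding AE_ball_countable[OF \<B>(2)]
  proof
    fix B assume "B \<in> \<B>"
    then obtain a b where "B = box a b" "cbox a b \<subseteq> D" using \<B>(1) by (auto simp: \<F>_def)
    then show "AE x in lebesgue. x \<in> B \<longrightarrow> f x = 0"
      using fundamental_lemma_box[OF assms(1,2) _ zero] by blast
  qed
  then have "AE x in lebesgue. x \<in> D \<longrightarrow> f x = 0"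
    using \<open>D \<subseteq> \<Union>\<F>\<close> unfolding \<B>(3)[symmetric] by (auto elim!: eventually_mono)
  then show ?thesis
    using assms(1) by (simp add: AE_lebesgue_on_iff borel_open)
qed

section \<open>Weak derivatives and their uniqueness\<close>

lemma locally_integrable_diff:
  "locally_integrable D f \<Longrightarrow> locally_integrable D g \<Longrightarrow> locally_integrable D (\<lambda>x. f x - g x)"
  by (simp add: locally_integrable_def)

lemma locally_integrable_add:
  "locally_integrable D f \<Longrightarrow> locally_integrable D g \<Longrightarrow> locally_integrable D (\<lambda>x. f x + g x)"
  by (simp add: locally_integrable_def)

lemma locally_integrable_vec_iff:
  fixes f :: "real^2 \<Rightarrow> real^2"
  shows "locally_integrable D f \<longleftrightarrow> (\<forall>j. locally_integrable D (\<lambda>x. f x $ j))"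
proof -
  have "f absolutely_integrable_on K \<longleftrightarrow> (\<forall>j. (\<lambda>x. f x $ j) absolutely_integrable_on K)" for K
    unfolding absolutely_integrable_componentwise_iff[of K f]
    by (auto simp: Basis_vec_def inner_axis)
  then show ?thesis by (auto simp: locally_integrable_def)
qed

lemma has_weak_grad_diff:
  assumes "open D" "has_weak_grad D u G" "has_weak_grad D v H"
  shows "has_weak_grad D (\<lambda>x. u x - v x) (\<lambda>x. G x - H x)"
  unfolding has_weak_grad_def
proof (intro conjI ballI allI)
  have u: "locally_integrable D u" "locally_integrable D v"
    and G: "locally_integrable D G" "locally_integrable D H"
    using assms by (auto simp: has_weak_grad_def)
  show "locally_integrable D (\<lambda>x. u x - v x)" "locally_integrable D (\<lambda>x. G x - H x)"
    by (intro locally_integrable_diff u G)+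
  fix \<phi> j assume \<phi>: "\<phi> \<in> test_functions D"
  have Gj: "locally_integrable D (\<lambda>x. G x $ j)" "locally_integrable D (\<lambda>x. H x $ j)"
    using G by (auto simp: locally_integrable_vec_iff)
  show "(LINT x|lebesgue_on D. (u x - v x) * grad \<phi> x $ j) =
      - (LINT x|lebesgue_on D. (G x - H x) $ j * \<phi> x)"
    using assms \<phi>
    by (simp add: left_diff_distrib integrable_test_function[OF assms(1)] u Gj has_weak_grad_def)
qed

lemma has_weak_grad_unique:
  assumes "open D" "has_weak_grad D u G" "has_weak_grad D u H"
  shows "AE x in lebesgue_on D. G x = H x"
proof -
  have *: "has_weak_grad D (\<lambda>x. 0) (\<lambda>x. G x - H x)"
    using has_weak_grad_diff[OF assms] by simp
  have "AE x in lebesgue_on D. (G x - H x) $ j = 0" for j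
  proof (rule fundamental_lemma[OF assms(1)])
    show "locally_integrable D (\<lambda>x. (G x - H x) $ j)"
      using * unfolding has_weak_grad_def by (metis locally_integrable_vec_iff)
  qed (use * in \<open>auto simp: has_weak_grad_def\<close>)
  then have "AE x in lebesgue_on D. \<forall>j. (G x - H x) $ j = 0"
    by (simp add: AE_all_countable)
  then show ?thesis by (simp add: vec_eq_iff)
qed

lemma has_weak_div_unique:
  assumes "open D" "has_weak_div D \<xi> d" "has_weak_div D \<xi> e"
  shows "AE x in lebesgue_on D. d x = e x"
proof -
  have loc: "locally_integrable D d" "locally_integrable D e"
    using assms by (auto simp: has_weak_div_def)
  have "AE x in lebesgue_on D. d x - e x = 0"
  proof (rule fundamental_lemma[OF assms(1) locally_integrable_diff[OF loc]])
    fix \<phi> assume \<phi>: "\<phi> \<in> test_functions D"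
    show "(LINT x|lebesgue_on D. (d x - e x) * \<phi> x) = 0"
      using assms \<phi>
      by (simp add: left_diff_distrib integrable_test_function[OF assms(1)] loc has_weak_div_def)
  qed
  then show ?thesis by simp
qed

text \<open>
  The chosen divergence of a field and the chosen gradients of its components are independent choices; by
  uniqueness, this link is what transfers the bound on the gradients of a deformation to its divergence.
\<close>

lemma has_weak_div_trace:
  assumes "open D" "\<And>i. has_weak_grad D (\<lambda>x. \<theta> x $ i) (G i)"
  shows "has_weak_div D \<theta> (\<lambda>x. \<Sum>i\<in>UNIV. G i x $ i)"
  unfolding has_weak_div_def
proof (intro conjI ballI)
  have \<theta>: "locally_integrable D (\<lambda>x. \<theta> x $ i)" and G: "locally_integrable D (\<lambda>x. G i x $ i)" for i
    using assms(2) locally_integrable_vec_iff by (auto simp: has_weak_grad_def)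
  show "locally_integrable D \<theta>" using \<theta> by (simp add: locally_integrable_vec_iff)
  show "locally_integrable D (\<lambda>x. \<Sum>i\<in>UNIV. G i x $ i)"
    unfolding sum_2 by (intro locally_integrable_add G)
  fix \<phi> assume \<phi>: "\<phi> \<in> test_functions D"
  show "(LINT x|lebesgue_on D. \<theta> x \<bullet> grad \<phi> x) =
      - (LINT x|lebesgue_on D. (\<Sum>i\<in>UNIV. G i x $ i) * \<phi> x)"
    using assms \<phi>
    by (simp add: inner_vec_def sum_distrib_right integrable_test_function[OF assms(1)] \<theta> G
        has_weak_grad_def sum_negf)
qed

section \<open>Square integrable and essentially bounded functions\<close>

lemma vec_measurable_iff:
  fixes f :: "'a \<Rightarrow> real^'n"
  shows "f \<in> borel_measurable M \<longleftrightarrow> (\<forall>j. (\<lambda>x. f x $ j) \<in> borel_measurable M)"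
  unfolding borel_measurable_euclidean_space[of f M] by (auto simp: Basis_vec_def inner_axis)

lemma LinfI: "f \<in> borel_measurable M \<Longrightarrow> (\<And>x. norm (f x) \<le> B) \<Longrightarrow> f \<in> Linf M"
  by (auto simp: Linf_def)

lemma Linf_add:
  assumes "f \<in> Linf M" "g \<in> Linf M"
  shows "(\<lambda>x. f x + g x) \<in> Linf M"
proof -
  obtain A B where "AE x in M. norm (f x) \<le> A" "AE x in M. norm (g x) \<le> B"
    using assms by (auto simp: Linf_def)
  then have "AE x in M. norm (f x + g x) \<le> A + B"
    by eventually_elim (rule norm_triangle_mono)
  then show ?thesis using assms by (auto simp: Linf_def)
qed

lemma Linf_cmult:
  assumes "f \<in> Linf M"
  shows "(\<lambda>x. c * f x :: real) \<in> Linf M"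
proof -
  obtain A where "AE x in M. norm (f x) \<le> A"
    using assms by (auto simp: Linf_def)
  then have "AE x in M. norm (c * f x) \<le> \<bar>c\<bar> * A"
    by eventually_elim (simp add: abs_mult mult_left_mono)
  then show ?thesis using assms by (auto simp: Linf_def)
qed

lemma Linf_component:
  fixes f :: "'a \<Rightarrow> real^'n"
  assumes "f \<in> Linf M"
  shows "(\<lambda>x. f x $ j) \<in> Linf M"
proof -
  obtain A where "AE x in M. norm (f x) \<le> A"
    using assms by (auto simp: Linf_def)
  then have "AE x in M. norm (f x $ j) \<le> A"
    by eventually_elim (metis component_le_norm_cart order_trans real_norm_def)
  then show ?thesis using assms by (auto simp: Linf_def vec_measurable_iff)
qed

lemma norm_add_power2_le:
  fixes a b :: "'a::real_normed_vector"
  shows "(norm (a + b))\<^sup>2 \<le> 2 * (norm a)\<^sup>2 + 2 * (norm b)\<^sup>2"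
proof -
  have "(norm (a + b))\<^sup>2 \<le> (norm a + norm b)\<^sup>2"
    by (intro power_mono norm_triangle_ineq) simp
  also have "\<dots> \<le> 2 * (norm a)\<^sup>2 + 2 * (norm b)\<^sup>2"
    using sum_squares_bound[of "norm a" "norm b"] unfolding power2_sum by linarith
  finally show ?thesis .
qed

lemma L2_add:
  assumes "f \<in> L2 M" "g \<in> L2 M"
  shows "(\<lambda>x. f x + g x) \<in> L2 M"
proof -
  have [measurable]: "f \<in> borel_measurable M" "g \<in> borel_measurable M"
    using assms by (auto simp: L2_def)
  have "integrable M (\<lambda>x. 2 * (norm (f x))\<^sup>2 + 2 * (norm (g x))\<^sup>2)"
    using assms by (auto simp: L2_def)
  then have "integrable M (\<lambda>x. (norm (f x + g x))\<^sup>2)"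
  proof (rule Bochner_Integration.integrable_bound)
    show "AE x in M. norm ((norm (f x + g x))\<^sup>2) \<le>
        norm (2 * (norm (f x))\<^sup>2 + 2 * (norm (g x))\<^sup>2)"
      using norm_add_power2_le[of "f _" "g _"] by simp
  qed measurable
  then show ?thesis by (simp add: L2_def)
qed

lemma L2_scaleR_Linf:
  fixes f :: "'a \<Rightarrow> real"
  assumes "f \<in> Linf M" "g \<in> L2 M"
  shows "(\<lambda>x. f x *\<^sub>R g x) \<in> L2 M"
proof -
  have [measurable]: "f \<in> borel_measurable M" "g \<in> borel_measurable M"
    using assms by (auto simp: L2_def Linf_def)
  obtain B where B: "AE x in M. norm (f x) \<le> B"
    using assms by (auto simp: Linf_def)
  have "integrable M (\<lambda>x. B\<^sup>2 * (norm (g x))\<^sup>2)"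
    using assms by (auto simp: L2_def)
  then have "integrable M (\<lambda>x. (norm (f x *\<^sub>R g x))\<^sup>2)"
  proof (rule Bochner_Integration.integrable_bound)
    show "AE x in M. norm ((norm (f x *\<^sub>R g x))\<^sup>2) \<le> norm (B\<^sup>2 * (norm (g x))\<^sup>2)"
      using B
    proof eventually_elim
      case (elim x)
      then have "\<bar>f x\<bar>\<^sup>2 \<le> B\<^sup>2" by (intro power_mono) auto
      then show ?case by (simp add: power_mult_distrib mult_right_mono)
    qed
  qed measurable
  then show ?thesis by (simp add: L2_def)
qed

lemma L2_mult_Linf:
  fixes f g :: "'a \<Rightarrow> real"
  shows "f \<in> Linf M \<Longrightarrow> g \<in> L2 M \<Longrightarrow> (\<lambda>x. f x * g x) \<in> L2 M"
  using L2_scaleR_Linf[of f M g] by simp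

lemma L2_diff:
  assumes "f \<in> L2 M" "g \<in> L2 M"
  shows "(\<lambda>x. f x - g x) \<in> L2 M"
  using L2_add[OF assms(1) L2_scaleR_Linf[OF LinfI[of "\<lambda>_. -1" M 1] assms(2)]] by simp

lemma integrable_inner_L2:
  assumes "f \<in> L2 M" "g \<in> L2 M"
  shows "integrable M (\<lambda>x. f x \<bullet> g x)"
proof -
  have [measurable]: "f \<in> borel_measurable M" "g \<in> borel_measurable M"
    using assms by (auto simp: L2_def)
  have "integrable M (\<lambda>x. (norm (f x))\<^sup>2 + (norm (g x))\<^sup>2)"
    using assms by (auto simp: L2_def)
  then show ?thesis
  proof (rule Bochner_Integration.integrable_bound)
    have "\<bar>f x \<bullet> g x\<bar> \<le> (norm (f x))\<^sup>2 + (norm (g x))\<^sup>2" for x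
      using Cauchy_Schwarz_ineq2[of "f x" "g x"] sum_squares_bound[of "norm (f x)" "norm (g x)"]
        mult_nonneg_nonneg[OF norm_ge_zero[of "f x"] norm_ge_zero[of "g x"]] by linarith
    then show "AE x in M. norm (f x \<bullet> g x) \<le> norm ((norm (f x))\<^sup>2 + (norm (g x))\<^sup>2)" by simp
  qed measurable
qed

lemma integrable_mult_L2:
  fixes f g :: "'a \<Rightarrow> real"
  shows "f \<in> L2 M \<Longrightarrow> g \<in> L2 M \<Longrightarrow> integrable M (\<lambda>x. f x * g x)"
  using integrable_inner_L2[of f M g] by simp

lemma L2_vec_iff:
  fixes f :: "'a \<Rightarrow> real^'n"
  shows "f \<in> L2 M \<longleftrightarrow> (\<forall>j. (\<lambda>x. f x $ j) \<in> L2 M)"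
proof
  assume f: "f \<in> L2 M"
  show "\<forall>j. (\<lambda>x. f x $ j) \<in> L2 M"
  proof
    fix j
    have [measurable]: "(\<lambda>x. f x $ j) \<in> borel_measurable M"
      using f by (simp add: L2_def vec_measurable_iff)
    have "integrable M (\<lambda>x. (norm (f x))\<^sup>2)" using f by (simp add: L2_def)
    then have "integrable M (\<lambda>x. (norm (f x $ j))\<^sup>2)"
    proof (rule Bochner_Integration.integrable_bound)
      have "(norm (f x $ j))\<^sup>2 \<le> (norm (f x))\<^sup>2" for x
        by (intro power_mono) (simp_all add: component_le_norm_cart)
      then show "AE x in M. norm ((norm (f x $ j))\<^sup>2) \<le> norm ((norm (f x))\<^sup>2)" by simp
    qed measurable
    then show "(\<lambda>x. f x $ j) \<in> L2 M" by (simp add: L2_def)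
  qed
next
  assume f: "\<forall>j. (\<lambda>x. f x $ j) \<in> L2 M"
  have "(norm (f x))\<^sup>2 = (\<Sum>j\<in>UNIV. (norm (f x $ j))\<^sup>2)" for x
    unfolding power2_norm_eq_inner[of "f x"] inner_vec_def by (simp add: power2_eq_square)
  then show "f \<in> L2 M"
    using f by (simp add: L2_def vec_measurable_iff)
qed

lemma L2_tendsto_diff:
  assumes meas[measurable]: "\<And>n. f n \<in> borel_measurable M" "\<And>n. g n \<in> borel_measurable M"
      "u \<in> borel_measurable M" "v \<in> borel_measurable M"
    and lim: "L2_tendsto M f u" "L2_tendsto M g v"
  shows "L2_tendsto M (\<lambda>n x. f n x - g n x) (\<lambda>x. u x - v x)"
proof -
  let ?I = "\<lambda>f u n. \<integral>\<^sup>+x. ennreal ((norm (f n x - u x))\<^sup>2) \<partial>M"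
  have pt: "ennreal ((norm (f n x - g n x - (u x - v x)))\<^sup>2) \<le>
      2 * ennreal ((norm (f n x - u x))\<^sup>2) + 2 * ennreal ((norm (g n x - v x))\<^sup>2)" for n x
  proof -
    have "(norm (f n x - g n x - (u x - v x)))\<^sup>2 \<le>
        2 * (norm (f n x - u x))\<^sup>2 + 2 * (norm (g n x - v x))\<^sup>2"
      using norm_add_power2_le[of "f n x - u x" "v x - g n x"]
      by (simp add: algebra_simps norm_minus_commute)
    then have "ennreal ((norm (f n x - g n x - (u x - v x)))\<^sup>2) \<le>
        ennreal (2 * (norm (f n x - u x))\<^sup>2 + 2 * (norm (g n x - v x))\<^sup>2)"
      by (rule ennreal_leI)
    then show ?thesis by (simp add: ennreal_plus ennreal_mult)
  qed
  have le: "(\<integral>\<^sup>+x. ennreal ((norm (f n x - g n x - (u x - v x)))\<^sup>2) \<partial>M) \<le> 2 * ?I f u n + 2 * ?I g v n" for n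
  proof -
    have "(\<integral>\<^sup>+x. ennreal ((norm (f n x - g n x - (u x - v x)))\<^sup>2) \<partial>M) \<le>
        (\<integral>\<^sup>+x. 2 * ennreal ((norm (f n x - u x))\<^sup>2) + 2 * ennreal ((norm (g n x - v x))\<^sup>2) \<partial>M)"
      by (intro nn_integral_mono pt)
    also have "\<dots> = 2 * ?I f u n + 2 * ?I g v n"
      by (simp add: nn_integral_add nn_integral_cmult)
    finally show ?thesis .
  qed
  have "(\<lambda>n. 2 * ?I f u n + 2 * ?I g v n) \<longlonglongrightarrow> 2 * 0 + 2 * 0"
    using lim by (intro tendsto_add ennreal_tendsto_cmult) (auto simp: L2_tendsto_def)
  then have "(\<lambda>n. 2 * ?I f u n + 2 * ?I g v n) \<longlonglongrightarrow> 0" by simp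
  from tendsto_sandwich[OF _ _ tendsto_const this] show ?thesis
    unfolding L2_tendsto_def using le by auto
qed

text \<open>
  By the Cauchy--Schwarz inequality, the squared deviation from the limit is at most the squared norm
  of \<open>f\<close> times the squared distance of \<open>g n\<close> and \<open>h\<close>.
\<close>

lemma L2_tendsto_integral_inner:
  assumes f: "f \<in> L2 M" and g: "\<And>n. g n \<in> L2 M" "h \<in> L2 M" and lim: "L2_tendsto M g h"
  shows "(\<lambda>n. LINT x|M. f x \<bullet> g n x) \<longlonglongrightarrow> (LINT x|M. f x \<bullet> h x)"
proof -
  have d: "(\<lambda>x. g n x - h x) \<in> L2 M" for n by (intro L2_diff g)
  have [measurable]: "f \<in> borel_measurable M" "(\<lambda>x. g n x - h x) \<in> borel_measurable M" for n
    using f d by (auto simp: L2_def)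
  let ?x = "\<lambda>n. LINT x|M. f x \<bullet> (g n x - h x)"
  let ?A = "\<integral>\<^sup>+x. ennreal ((norm (f x))\<^sup>2) \<partial>M"
  let ?e = "\<lambda>n. \<integral>\<^sup>+x. ennreal ((norm (g n x - h x))\<^sup>2) \<partial>M"
  have A: "?A < top"
    using f by (simp add: L2_def integrable_iff_bounded)
  have bound: "ennreal ((?x n)\<^sup>2) \<le> ?A * ?e n" for n
  proof -
    have "ennreal (norm (?x n)) \<le> (\<integral>\<^sup>+x. norm (f x \<bullet> (g n x - h x)) \<partial>M)"
      by (intro integral_norm_bound_ennreal integrable_inner_L2 f d)
    also have "\<dots> \<le> (\<integral>\<^sup>+x. ennreal (norm (f x)) * ennreal (norm (g n x - h x)) \<partial>M)"
      by (intro nn_integral_mono) (simp flip: ennreal_mult add: ennreal_leI Cauchy_Schwarz_ineq2)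
    finally have "(ennreal (norm (?x n)))\<^sup>2 \<le>
        (\<integral>\<^sup>+x. ennreal (norm (f x)) * ennreal (norm (g n x - h x)) \<partial>M)\<^sup>2"
      by (rule power_mono) simp
    also have "\<dots> \<le> (\<integral>\<^sup>+x. (ennreal (norm (f x)))\<^sup>2 \<partial>M) * (\<integral>\<^sup>+x. (ennreal (norm (g n x - h x)))\<^sup>2 \<partial>M)"
      by (rule Cauchy_Schwarz_nn_integral) measurable
    finally show ?thesis by (simp add: ennreal_power)
  qed
  have "(\<lambda>n. ?A * ?e n) \<longlonglongrightarrow> ?A * 0"
    using A lim by (intro ennreal_tendsto_cmult) (auto simp: L2_tendsto_def)
  then have "(\<lambda>n. ?A * ?e n) \<longlonglongrightarrow> 0" by simp
  from tendsto_sandwich[OF _ _ tendsto_const this, of "\<lambda>n. ennreal ((?x n)\<^sup>2)"] bound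
  have "(\<lambda>n. ennreal ((?x n)\<^sup>2)) \<longlonglongrightarrow> ennreal 0" by simp
  then have "(\<lambda>n. (?x n)\<^sup>2) \<longlonglongrightarrow> 0"
    by (rule tendsto_ennrealD) auto
  from tendsto_real_sqrt[OF this] have "?x \<longlonglongrightarrow> 0"
    by (simp add: tendsto_rabs_zero_iff)
  then have "(\<lambda>n. (LINT x|M. f x \<bullet> h x) + ?x n) \<longlonglongrightarrow> (LINT x|M. f x \<bullet> h x) + 0"
    by (intro tendsto_intros)
  moreover have "(LINT x|M. f x \<bullet> h x) + ?x n = (LINT x|M. f x \<bullet> g n x)" for n
    by (simp add: inner_diff_right integrable_inner_L2 f g)
  ultimately show ?thesis by simp
qed

text \<open>
  Completeness of Lebesgue measure: membership in the spaces below passes between representatives, in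
  particular to the chosen weak derivatives.
\<close>

lemma measurable_lebesgue_on_AE:
  fixes f g :: "'a::euclidean_space \<Rightarrow> 'b::euclidean_space"
  assumes D: "D \<in> sets lebesgue" and f: "f \<in> borel_measurable (lebesgue_on D)"
    and eq: "AE x in lebesgue_on D. f x = g x"
  shows "g \<in> borel_measurable (lebesgue_on D)"
proof -
  have "AE x in lebesgue. (if x \<in> D then f x else 0) = (if x \<in> D then g x else 0)"
    using eq unfolding AE_lebesgue_on_iff[OF D] by eventually_elim simp
  with f show ?thesis
    unfolding borel_measurable_if[OF D, symmetric] by (rule borel_measurable_AE)
qed

lemma L2_lebesgue_on_AE:
  assumes D: "D \<in> sets lebesgue" and f: "f \<in> L2 (lebesgue_on D)"
    and eq: "AE x in lebesgue_on D. f x = g x"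
  shows "g \<in> L2 (lebesgue_on D)"
proof -
  have [measurable]: "f \<in> borel_measurable (lebesgue_on D)" "g \<in> borel_measurable (lebesgue_on D)"
    using f measurable_lebesgue_on_AE[OF D _ eq] by (auto simp: L2_def)
  have "integrable (lebesgue_on D) (\<lambda>x. (norm (f x))\<^sup>2) \<longleftrightarrow> integrable (lebesgue_on D) (\<lambda>x. (norm (g x))\<^sup>2)"
    using eq by (intro integrable_cong_AE) auto
  then show ?thesis using f by (simp add: L2_def)
qed

lemma Linf_lebesgue_on_AE:
  assumes D: "D \<in> sets lebesgue" and f: "f \<in> Linf (lebesgue_on D)"
    and eq: "AE x in lebesgue_on D. f x = g x"
  shows "g \<in> Linf (lebesgue_on D)"
proof -
  obtain B where "AE x in lebesgue_on D. norm (f x) \<le> B"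
    using f by (auto simp: Linf_def)
  with eq have "AE x in lebesgue_on D. norm (g x) \<le> B"
    by eventually_elim simp
  then show ?thesis
    using f measurable_lebesgue_on_AE[OF D _ eq] by (auto simp: Linf_def)
qed

section \<open>Weak derivatives of Sobolev functions\<close>

lemma wgrad_AE_eq:
  assumes "open D" "has_weak_grad D u G"
  shows "has_weak_grad D u (wgrad D u)" and "AE x in lebesgue_on D. G x = wgrad D u x"
proof -
  show "has_weak_grad D u (wgrad D u)"
    unfolding wgrad_def by (rule someI[of "has_weak_grad D u", OF assms(2)])
  then show "AE x in lebesgue_on D. G x = wgrad D u x"
    by (rule has_weak_grad_unique[OF assms])
qed

lemma wdiv_AE_eq:
  assumes "open D" "has_weak_div D \<xi> d"
  shows "has_weak_div D \<xi> (wdiv D \<xi>)" and "AE x in lebesgue_on D. d x = wdiv D \<xi> x"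
proof -
  show "has_weak_div D \<xi> (wdiv D \<xi>)"
    unfolding wdiv_def by (rule someI[of "has_weak_div D \<xi>", OF assms(2)])
  then show "AE x in lebesgue_on D. d x = wdiv D \<xi> x"
    by (rule has_weak_div_unique[OF assms])
qed

lemma H1_D:
  assumes "open D" "u \<in> H1 D"
  shows "u \<in> L2 (lebesgue_on D)" "has_weak_grad D u (wgrad D u)" "wgrad D u \<in> L2 (lebesgue_on D)"
proof -
  obtain G where G: "has_weak_grad D u G" "G \<in> L2 (lebesgue_on D)"
    using assms(2) by (auto simp: H1_def)
  show "u \<in> L2 (lebesgue_on D)" using assms(2) by (simp add: H1_def)
  show "has_weak_grad D u (wgrad D u)" by (rule wgrad_AE_eq(1)[OF assms(1) G(1)])
  show "wgrad D u \<in> L2 (lebesgue_on D)"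
    using assms(1) by (intro L2_lebesgue_on_AE[OF _ G(2) wgrad_AE_eq(2)[OF assms(1) G(1)]])
      (simp add: borel_open)
qed

lemma Hdiv_D:
  assumes "open D" "\<xi> \<in> Hdiv D"
  shows "\<xi> \<in> L2 (lebesgue_on D)" "has_weak_div D \<xi> (wdiv D \<xi>)" "wdiv D \<xi> \<in> L2 (lebesgue_on D)"
proof -
  obtain d where d: "has_weak_div D \<xi> d" "d \<in> L2 (lebesgue_on D)"
    using assms(2) by (auto simp: Hdiv_def)
  show "\<xi> \<in> L2 (lebesgue_on D)" using assms(2) by (simp add: Hdiv_def)
  show "has_weak_div D \<xi> (wdiv D \<xi>)" by (rule wdiv_AE_eq(1)[OF assms(1) d(1)])
  show "wdiv D \<xi> \<in> L2 (lebesgue_on D)"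
    using assms(1) by (intro L2_lebesgue_on_AE[OF _ d(2) wdiv_AE_eq(2)[OF assms(1) d(1)]])
      (simp add: borel_open)
qed

text \<open>
  Linearity of the chosen gradient holds only almost everywhere: the difference of the two gradients is one
  weak gradient of the difference, and uniqueness identifies it with the chosen one.
\<close>

lemma H1_diff:
  assumes "open D" "u \<in> H1 D" "v \<in> H1 D"
  shows "(\<lambda>x. u x - v x) \<in> H1 D"
    and "AE x in lebesgue_on D. wgrad D u x - wgrad D v x = wgrad D (\<lambda>x. u x - v x) x"
proof -
  note u = H1_D[OF assms(1,2)] and v = H1_D[OF assms(1,3)]
  note wg = has_weak_grad_diff[OF assms(1) u(2) v(2)]
  show "(\<lambda>x. u x - v x) \<in> H1 D"
    using L2_diff[OF u(1) v(1)] L2_diff[OF u(3) v(3)] wg unfolding H1_def by blast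
  show "AE x in lebesgue_on D. wgrad D u x - wgrad D v x = wgrad D (\<lambda>x. u x - v x) x"
    by (rule wgrad_AE_eq(2)[OF assms(1) wg])
qed

lemma W1inf_Linf:
  assumes "open D" "\<theta> \<in> W1inf D"
  shows "(\<lambda>x. M_mat D \<theta> x $ i $ j) \<in> Linf (lebesgue_on D)" "wdiv D \<theta> \<in> Linf (lebesgue_on D)"
proof -
  have D: "D \<in> sets lebesgue" using assms(1) by (simp add: borel_open)
  have wg: "has_weak_grad D (\<lambda>x. \<theta> x $ i) (wgrad D (\<lambda>x. \<theta> x $ i))"
    and G: "wgrad D (\<lambda>x. \<theta> x $ i) \<in> Linf (lebesgue_on D)" for i
  proof -
    obtain G where G: "has_weak_grad D (\<lambda>x. \<theta> x $ i) G" "G \<in> Linf (lebesgue_on D)"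
      using assms(2) by (auto simp: W1inf_def)
    show "has_weak_grad D (\<lambda>x. \<theta> x $ i) (wgrad D (\<lambda>x. \<theta> x $ i))"
      by (rule wgrad_AE_eq(1)[OF assms(1) G(1)])
    show "wgrad D (\<lambda>x. \<theta> x $ i) \<in> Linf (lebesgue_on D)"
      by (rule Linf_lebesgue_on_AE[OF D G(2) wgrad_AE_eq(2)[OF assms(1) G(1)]])
  qed
  note J = Linf_component[OF G]
  have "(\<lambda>x. \<Sum>i\<in>UNIV. wgrad D (\<lambda>x. \<theta> x $ i) x $ i) \<in> Linf (lebesgue_on D)"
    unfolding sum_2 by (intro Linf_add J)
  then show div: "wdiv D \<theta> \<in> Linf (lebesgue_on D)"
    by (rule Linf_lebesgue_on_AE[OF D _ wdiv_AE_eq(2)[OF assms(1) has_weak_div_trace[OF assms(1) wg]]])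
  have "(\<lambda>x. wgrad D (\<lambda>y. \<theta> y $ i) x $ j + wgrad D (\<lambda>y. \<theta> y $ j) x $ i
      + (- (mat 1 :: real^2^2) $ i $ j) * wdiv D \<theta> x) \<in> Linf (lebesgue_on D)"
    by (intro Linf_add Linf_cmult J div)
  then show "(\<lambda>x. M_mat D \<theta> x $ i $ j) \<in> Linf (lebesgue_on D)"
    by (simp add: M_mat_def wjac_def transpose_def algebra_simps)
qed

lemma L2_matrix_vector:
  fixes A :: "'a \<Rightarrow> real^2^2"
  assumes "\<And>i j. (\<lambda>x. A x $ i $ j) \<in> Linf M" "w \<in> L2 M"
  shows "(\<lambda>x. A x *v w x) \<in> L2 M"
  unfolding L2_vec_iff
proof
  fix i
  have "(\<lambda>x. A x $ i $ 1 * w x $ 1 + A x $ i $ 2 * w x $ 2) \<in> L2 M"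
    using assms by (intro L2_add L2_mult_Linf) (auto simp: L2_vec_iff)
  then show "(\<lambda>x. (A x *v w x) $ i) \<in> L2 M"
    by (simp add: matrix_vector_mult_def sum_2)
qed

section \<open>Green's formula without boundary term\<close>

lemma test_function_L2:
  assumes "open D" "\<phi> \<in> test_functions D"
  shows "\<phi> \<in> L2 (lebesgue_on D)" "grad \<phi> \<in> L2 (lebesgue_on D)"
proof -
  note \<phi> = test_functionsD[OF assms(2)]
  have D: "D \<in> sets lebesgue" using assms(1) by (simp add: borel_open)
  \<comment> \<open>The square of a continuous function of compact support is integrated against the locally integrable constant one.\<close>
  have one: "locally_integrable D (\<lambda>_. 1 :: real)"
    by (auto simp: locally_integrable_def intro!: absolutely_integrable_on_const lmeasurable_compact)
  have L2: "f \<in> L2 (lebesgue_on D)"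
    if f: "continuous_on UNIV f" and zero: "\<And>x. x \<notin> closure {x. \<phi> x \<noteq> 0} \<Longrightarrow> f x = 0"
    for f :: "real^2 \<Rightarrow> real"
  proof -
    have "f \<in> borel_measurable (lebesgue_on D)"
      using continuous_on_subset[OF f] D by (intro continuous_imp_measurable_on_sets_lebesgue) auto
    moreover have "integrable (lebesgue_on D) (\<lambda>x. 1 * (f x)\<^sup>2)"
      by (rule integrable_compact_support[OF assms(1) one _ \<phi>(2,3)])
        (auto intro!: continuous_on_power f simp: zero)
    ultimately show ?thesis by (simp add: L2_def)
  qed
  show "\<phi> \<in> L2 (lebesgue_on D)"
    by (rule L2[OF smooth_continuous[OF \<phi>(1)] \<phi>(4)])
  show "grad \<phi> \<in> L2 (lebesgue_on D)"
    unfolding L2_vec_iff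
    by (intro allI L2 smooth_continuous_grad \<phi>(1)) (simp add: grad_zero_outside)
qed

lemma H10_diff:
  assumes "open D" "u \<in> H10 D" "v \<in> H10 D"
  shows "(\<lambda>x. u x - v x) \<in> H10 D"
proof -
  obtain \<phi> where \<phi>: "\<And>n. \<phi> n \<in> test_functions D" "H1_tendsto D \<phi> u"
    using assms(2) by (auto simp: H10_def)
  obtain \<psi> where \<psi>: "\<And>n. \<psi> n \<in> test_functions D" "H1_tendsto D \<psi> v"
    using assms(3) by (auto simp: H10_def)
  have H1: "u \<in> H1 D" "v \<in> H1 D" using assms by (auto simp: H10_def)
  note u = H1_D[OF assms(1) H1(1)] and v = H1_D[OF assms(1) H1(2)]
  note T = test_function_L2[OF assms(1) \<phi>(1)] test_function_L2[OF assms(1) \<psi>(1)]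
  have meas: "f \<in> L2 M \<Longrightarrow> f \<in> borel_measurable M"
    for f :: "real^2 \<Rightarrow> 'b::euclidean_space" and M
    by (simp add: L2_def)
  have "L2_tendsto (lebesgue_on D) (\<lambda>n x. \<phi> n x - \<psi> n x) (\<lambda>x. u x - v x)"
    using \<phi>(2) \<psi>(2) by (intro L2_tendsto_diff meas T u v) (auto simp: H1_tendsto_def)
  moreover have "L2_tendsto (lebesgue_on D) (\<lambda>n. grad (\<lambda>x. \<phi> n x - \<psi> n x)) (wgrad D (\<lambda>x. u x - v x))"
  proof -
    have "L2_tendsto (lebesgue_on D) (\<lambda>n x. grad (\<phi> n) x - grad (\<psi> n) x) (\<lambda>x. wgrad D u x - wgrad D v x)"
      using \<phi>(2) \<psi>(2) by (intro L2_tendsto_diff meas T u v) (auto simp: H1_tendsto_def)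
    moreover have "(\<integral>\<^sup>+x. ennreal ((norm (f x - (wgrad D u x - wgrad D v x)))\<^sup>2) \<partial>lebesgue_on D) =
        (\<integral>\<^sup>+x. ennreal ((norm (f x - wgrad D (\<lambda>x. u x - v x) x))\<^sup>2) \<partial>lebesgue_on D)" for f
      by (rule nn_integral_cong_AE) (use H1_diff(2)[OF assms(1) H1] in eventually_elim, simp)
    ultimately show ?thesis
      by (simp add: L2_tendsto_def grad_diff[OF test_functionsD(1)[OF \<phi>(1)] test_functionsD(1)[OF \<psi>(1)]])
  qed
  ultimately have "H1_tendsto D (\<lambda>n x. \<phi> n x - \<psi> n x) (\<lambda>x. u x - v x)"
    by (simp add: H1_tendsto_def)
  moreover have "\<forall>n. (\<lambda>x. \<phi> n x - \<psi> n x) \<in> test_functions D"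
    by (intro allI test_functions_diff \<phi> \<psi>)
  ultimately show ?thesis
    using H1_diff(1)[OF assms(1) H1] unfolding H10_def mem_Collect_eq
    by (intro conjI exI[of _ "\<lambda>n x. \<phi> n x - \<psi> n x"])
qed

text \<open>
  For a test function Green's formula is the definition of the weak divergence; both sides are
  continuous along H1 convergence.
\<close>

lemma normal_trace_H10:
  assumes "open D" "\<xi> \<in> Hdiv D" "v \<in> H10 D"
  shows "normal_trace D \<xi> v = 0"
proof -
  obtain \<phi> where \<phi>: "\<And>n. \<phi> n \<in> test_functions D" "H1_tendsto D \<phi> v"
    using assms(3) by (auto simp: H10_def)
  have "v \<in> H1 D" using assms(3) by (auto simp: H10_def)
  note v = H1_D[OF assms(1) this] and \<xi> = Hdiv_D[OF assms(1,2)]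
  note T = test_function_L2[OF assms(1) \<phi>(1)]
  have "(\<lambda>n. LINT x|lebesgue_on D. \<xi> x \<bullet> grad (\<phi> n) x) \<longlonglongrightarrow> (LINT x|lebesgue_on D. \<xi> x \<bullet> wgrad D v x)"
    using \<phi>(2) by (intro L2_tendsto_integral_inner \<xi> T v) (simp add: H1_tendsto_def)
  moreover have "(LINT x|lebesgue_on D. \<xi> x \<bullet> grad (\<phi> n) x) = - (LINT x|lebesgue_on D. wdiv D \<xi> x \<bullet> \<phi> n x)" for n
    using \<xi>(2) \<phi>(1) by (simp add: has_weak_div_def)
  moreover have "(\<lambda>n. - (LINT x|lebesgue_on D. wdiv D \<xi> x \<bullet> \<phi> n x)) \<longlonglongrightarrow>
      - (LINT x|lebesgue_on D. wdiv D \<xi> x \<bullet> v x)"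
    using \<phi>(2) by (intro tendsto_minus L2_tendsto_integral_inner \<xi> T v) (simp add: H1_tendsto_def)
  ultimately have "(LINT x|lebesgue_on D. \<xi> x \<bullet> wgrad D v x) = - (LINT x|lebesgue_on D. wdiv D \<xi> x \<bullet> v x)"
    using LIMSEQ_unique by simp
  then show ?thesis
    by (simp add: normal_trace_def integrable_inner_L2 integrable_mult_L2 \<xi> v)
qed

section \<open>The a posteriori estimate\<close>

text \<open>
  Expanding \<open>\<bar>A - k w\<bar>\<^sup>2 / k \<ge> 0\<close> gives \<open>2 A \<bullet> w \<le> \<bar>A\<bar>\<^sup>2 / k + k \<bar>w\<bar>\<^sup>2\<close>, and similarly for the terms
  of order zero. Integration bounds twice the right hand side of \<open>eq\<close> by the claimed bound plus the
  energy, and the energy equals that right hand side.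
\<close>

lemma weighted_energy_bound:
  fixes A w :: "'a \<Rightarrow> 'b::euclidean_space" and B e k :: "'a \<Rightarrow> real"
  assumes L2: "A \<in> L2 M" "w \<in> L2 M" "B \<in> L2 M" "e \<in> L2 M"
    and k: "k \<in> Linf M" "(\<lambda>x. inverse (k x)) \<in> Linf M" "\<And>x. k x > 0"
    and eq: "(LINT x|M. k x * (w x \<bullet> w x) + e x * e x) = (LINT x|M. A x \<bullet> w x + B x * e x)"
  shows "(LINT x|M. k x * (w x \<bullet> w x) + e x * e x) \<le> (LINT x|M. inverse (k x) * (norm (A x))\<^sup>2 + \<bar>B x\<bar>\<^sup>2)"
proof -
  let ?E = "\<lambda>x. k x * (w x \<bullet> w x) + e x * e x"
    and ?R = "\<lambda>x. inverse (k x) * (norm (A x))\<^sup>2 + \<bar>B x\<bar>\<^sup>2"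
    and ?P = "\<lambda>x. A x \<bullet> w x + B x * e x"
  have intE: "integrable M ?E"
    using integrable_inner_L2[OF L2_scaleR_Linf[OF k(1) L2(2)] L2(2)] L2
    by (simp add: integrable_mult_L2)
  have intR: "integrable M ?R"
    using integrable_inner_L2[OF L2_scaleR_Linf[OF k(2) L2(1)] L2(1)] integrable_mult_L2[OF L2(3,3)]
    by (simp add: power2_norm_eq_inner power2_eq_square[of "B _"])
  have intP: "integrable M ?P"
    using L2 by (simp add: integrable_inner_L2 integrable_mult_L2)
  have "2 * ?P x \<le> ?R x + ?E x" for x
  proof -
    have "0 \<le> inverse (k x) * ((A x - k x *\<^sub>R w x) \<bullet> (A x - k x *\<^sub>R w x))"
      using k(3)[of x] by simp
    also have "\<dots> = inverse (k x) * (norm (A x))\<^sup>2 - 2 * (A x \<bullet> w x) + k x * (w x \<bullet> w x)"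
      using k(3)[of x]
      by (simp add: inner_diff_left inner_diff_right inner_commute power2_norm_eq_inner field_simps)
    finally have "2 * (A x \<bullet> w x) \<le> inverse (k x) * (norm (A x))\<^sup>2 + k x * (w x \<bullet> w x)" by simp
    moreover have "2 * (B x * e x) \<le> \<bar>B x\<bar>\<^sup>2 + e x * e x"
      using sum_squares_bound[of "B x" "e x"] by (simp add: power2_eq_square)
    ultimately show ?thesis by (simp add: algebra_simps)
  qed
  then have "(LINT x|M. 2 * ?P x) \<le> (LINT x|M. ?R x + ?E x)"
    by (intro integral_mono Bochner_Integration.integrable_add integrable_mult_right intE intR intP)
  also have "\<dots> = (LINT x|M. ?R x) + (LINT x|M. ?E x)"
    by (rule Bochner_Integration.integral_add[OF intR intE])
  finally have "2 * (LINT x|M. ?P x) \<le> (LINT x|M. ?R x) + (LINT x|M. ?E x)"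
    by (subst (asm) integral_mult_right_zero)
  then show ?thesis unfolding eq by linarith
qed

lemma conductivity_pos:
  assumes "kI > 0" "kE > 0"
  shows "conductivity kI kE \<Omega> x > 0"
  using assms by (simp add: conductivity_def indicator_def)

lemma conductivity_Linf:
  assumes "open \<Omega>"
  shows "conductivity kI kE \<Omega> \<in> Linf (lebesgue_on D)"
    "(\<lambda>x. inverse (conductivity kI kE \<Omega> x)) \<in> Linf (lebesgue_on D)"
proof -
  have "indicator \<Omega> \<in> borel_measurable lebesgue"
    using assms by (intro borel_measurable_indicator) (simp add: borel_open)
  then have [measurable]: "indicat_real \<Omega> \<in> borel_measurable (lebesgue_on D)"
    by (rule measurable_restrict_space1)
  have [measurable]: "conductivity kI kE \<Omega> \<in> borel_measurable (lebesgue_on D)"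
    unfolding conductivity_def[abs_def] by measurable
  show "conductivity kI kE \<Omega> \<in> Linf (lebesgue_on D)"
    by (rule LinfI[where B = "max \<bar>kI\<bar> \<bar>kE\<bar>"], measurable)
      (auto simp: conductivity_def indicator_def)
  show "(\<lambda>x. inverse (conductivity kI kE \<Omega> x)) \<in> Linf (lebesgue_on D)"
    by (rule LinfI[where B = "max \<bar>inverse kI\<bar> \<bar>inverse kE\<bar>"], measurable)
      (auto simp: conductivity_def indicator_def)
qed

theorem mainTheorem2:
  fixes D \<Omega> :: "(real^2) set" and kI kE :: real and k :: "real^2 \<Rightarrow> real"
    and g U\<^sub>D :: "real^2 \<Rightarrow> real" and \<theta> :: "real^2 \<Rightarrow> real^2"
    and \<T> \<T>' :: "(real^2 \<Rightarrow> real^2) set" and p m :: nat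
    and i :: bdry and u r rh :: "real^2 \<Rightarrow> real" and \<xi> :: "real^2 \<Rightarrow> real^2"
  defines "k \<equiv> conductivity kI kE \<Omega>"
  assumes D: "open D" "bounded D" "lipschitz_boundary D"
    and Omega: "open \<Omega>" "lipschitz_boundary \<Omega>" "compact (closure \<Omega>)" "closure \<Omega> \<subseteq> D"
    and k_pos: "kI > 0" "kE > 0"
    and data: "g \<in> L2 (surface D)" "U\<^sub>D \<in> H_half D"
    and theta: "\<theta> \<in> W1inf D" "\<forall>j. has_trace D (\<lambda>x. \<theta> x $ j) (\<lambda>x. 0)"
    and meshes: "triangulation D \<T>" "p \<ge> 1" "triangulation D \<T>'"
    and state: "discrete_state D k g U\<^sub>D \<T> p i u"
    and adjoint: "r \<in> space_V D i" "\<forall>v\<in>space_V D i. form_a D k v r = adjoint_rhs D k \<theta> u v"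
    and discrete_adjoint: "rh \<in> space_Vh D \<T> p i"
      "\<forall>v\<in>space_Vh D \<T> p i. form_a D k v rh = adjoint_rhs D k \<theta> u v"
    and flux: "discrete_flux D k \<theta> u \<T>' m i \<xi>"
  shows "(energy_norm D k (\<lambda>x. r x - rh x))\<^sup>2 \<le>
    (LINT x|lebesgue_on D.
       inverse (k x) *
         (norm (\<xi> x + k x *\<^sub>R (M_mat D \<theta> x *v wgrad D u x) - k x *\<^sub>R wgrad D rh x))\<^sup>2 +
       \<bar>wdiv D \<xi> x - wdiv D \<theta> x * u x - rh x\<bar>\<^sup>2)"
proof -
  define e where "e = (\<lambda>x. r x - rh x)"
  define w where "w = wgrad D e"
  let ?M = "lebesgue_on D"
  let ?A = "\<lambda>x. \<xi> x + k x *\<^sub>R (M_mat D \<theta> x *v wgrad D u x) - k x *\<^sub>R wgrad D rh x"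
    and ?B = "\<lambda>x. wdiv D \<xi> x - wdiv D \<theta> x * u x - rh x"
  have V_H1: "space_V D i \<subseteq> H1 D"
    by (cases i) (auto simp: H10_def)
  have V: "r \<in> space_V D i" "rh \<in> space_V D i"
    using adjoint(1) discrete_adjoint(1) by (auto simp: space_Vh_def)
  have e_V: "e \<in> space_V D i"
    unfolding e_def using V H1_diff(1)[OF D(1)] H10_diff[OF D(1)] by (cases i) auto
  have u_H1: "u \<in> H1 D"
    using state by (simp add: discrete_state_def)
  have \<xi>_Hdiv: "\<xi> \<in> Hdiv D"
    using flux by (simp add: discrete_flux_def space_Sigma_h_def RT_space_def)
  have k_gt: "k x > 0" for x
    unfolding k_def by (rule conductivity_pos[OF k_pos])
  have k: "k \<in> Linf ?M" "(\<lambda>x. inverse (k x)) \<in> Linf ?M"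
    unfolding k_def by (rule conductivity_Linf[OF Omega(1)])+
  note r = H1_D[OF D(1) subsetD[OF V_H1 V(1)]] and rh = H1_D[OF D(1) subsetD[OF V_H1 V(2)]]
    and e = H1_D[OF D(1) subsetD[OF V_H1 e_V], folded w_def] and u = H1_D[OF D(1) u_H1]
    and \<xi> = Hdiv_D[OF D(1) \<xi>_Hdiv]
  have flux_L2: "(\<lambda>x. k x *\<^sub>R (M_mat D \<theta> x *v wgrad D u x)) \<in> L2 ?M"
    by (intro L2_scaleR_Linf k L2_matrix_vector W1inf_Linf[OF D(1) theta(1)] u)
  have div_L2: "(\<lambda>x. wdiv D \<theta> x * u x) \<in> L2 ?M"
    by (intro L2_mult_Linf W1inf_Linf[OF D(1) theta(1)] u)
  have grad_L2: "(\<lambda>x. k x *\<^sub>R w x) \<in> L2 ?M" "(\<lambda>x. k x *\<^sub>R wgrad D rh x) \<in> L2 ?M"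
      "(\<lambda>x. k x *\<^sub>R wgrad D r x) \<in> L2 ?M"
    by (intro L2_scaleR_Linf k e rh r)+
  have A: "?A \<in> L2 ?M" and B: "?B \<in> L2 ?M"
    by (intro L2_add L2_diff \<xi> flux_L2 div_L2 grad_L2 rh)+
  have green: "(LINT x|?M. \<xi> x \<bullet> w x + wdiv D \<xi> x * e x) = 0"
  proof -
    have "normal_trace D \<xi> e = 0"
    proof (cases i)
      case Neumann
      then show ?thesis
        using flux e_V by (auto simp: discrete_flux_def space_Sigma_h_def zero_normal_trace_def)
    next
      case Dirichlet
      then show ?thesis
        using normal_trace_H10[OF D(1) \<xi>_Hdiv] e_V by simp
    qed
    then show ?thesis by (simp add: normal_trace_def w_def)
  qed
  have split: "form_a D k e e = form_a D k e r - form_a D k e rh"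
  proof -
    have "AE x in ?M. w x = wgrad D r x - wgrad D rh x"
      using H1_diff(2)[OF D(1) subsetD[OF V_H1 V(1)] subsetD[OF V_H1 V(2)]]
      unfolding w_def e_def by eventually_elim simp
    then have "AE x in ?M. k x * (w x \<bullet> w x) + e x * e x =
        (k x * (w x \<bullet> wgrad D r x) + e x * r x) - (k x * (w x \<bullet> wgrad D rh x) + e x * rh x)"
    proof eventually_elim
      case (elim x)
      have "w x \<bullet> w x = w x \<bullet> wgrad D r x - w x \<bullet> wgrad D rh x"
        by (subst (2) elim) (rule inner_diff_right)
      then have "k x * (w x \<bullet> w x) = k x * (w x \<bullet> wgrad D r x) - k x * (w x \<bullet> wgrad D rh x)"
        by (simp only: right_diff_distrib)
      moreover have "e x * e x = e x * r x - e x * rh x"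
        by (simp add: e_def right_diff_distrib)
      ultimately show ?case by linarith
    qed
    moreover have int: "integrable ?M (\<lambda>x. k x * (w x \<bullet> z x) + e x * y x)"
      if "z \<in> L2 ?M" "y \<in> L2 ?M" for z y
      using integrable_inner_L2[OF grad_L2(1) that(1)] integrable_mult_L2[OF e(1) that(2)] by simp
    ultimately have "(LINT x|?M. k x * (w x \<bullet> w x) + e x * e x) =
        (LINT x|?M. (k x * (w x \<bullet> wgrad D r x) + e x * r x) - (k x * (w x \<bullet> wgrad D rh x) + e x * rh x))"
      using int[OF e(3,1)] int[OF r(3,1)] int[OF rh(3,1)]
      by (intro integral_cong_AE borel_measurable_integrable Bochner_Integration.integrable_diff)
    also have "\<dots> = form_a D k e r - form_a D k e rh"
      unfolding form_a_def w_def[symmetric]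
      using int[OF r(3,1)] int[OF rh(3,1)] by (rule Bochner_Integration.integral_diff)
    finally show ?thesis unfolding form_a_def w_def[symmetric] .
  qed
  have "form_a D k e r = adjoint_rhs D k \<theta> u e"
    using adjoint(2) e_V by blast
  \<comment> \<open>Green's formula enters as a zero, which brings the flux into the error identity.\<close>
  with split green have "form_a D k e e = adjoint_rhs D k \<theta> u e - form_a D k e rh
      + (LINT x|?M. \<xi> x \<bullet> w x + wdiv D \<xi> x * e x)" by simp
  also have "\<dots> = (LINT x|?M. ?A x \<bullet> w x + ?B x * e x)"
  proof -
    have int: "integrable ?M (\<lambda>x. k x * ((M_mat D \<theta> x *v wgrad D u x) \<bullet> w x) - wdiv D \<theta> x * u x * e x)"
      "integrable ?M (\<lambda>x. k x * (w x \<bullet> wgrad D rh x) + e x * rh x)"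
      "integrable ?M (\<lambda>x. \<xi> x \<bullet> w x + wdiv D \<xi> x * e x)"
      using integrable_inner_L2[OF flux_L2 e(3)] integrable_mult_L2[OF div_L2 e(1)]
        integrable_inner_L2[OF grad_L2(1) rh(3)] integrable_mult_L2[OF e(1) rh(1)]
        integrable_inner_L2[OF \<xi>(1) e(3)] integrable_mult_L2[OF \<xi>(3) e(1)]
      by simp_all
    have "(LINT x|?M. ?A x \<bullet> w x + ?B x * e x) =
        (LINT x|?M. (k x * ((M_mat D \<theta> x *v wgrad D u x) \<bullet> w x) - wdiv D \<theta> x * u x * e x
          - (k x * (w x \<bullet> wgrad D rh x) + e x * rh x)) + (\<xi> x \<bullet> w x + wdiv D \<xi> x * e x))"
      by (intro Bochner_Integration.integral_cong)
        (simp_all add: inner_add_left inner_diff_left inner_commute algebra_simps)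
    also have "\<dots> = adjoint_rhs D k \<theta> u e - form_a D k e rh
      + (LINT x|?M. \<xi> x \<bullet> w x + wdiv D \<xi> x * e x)"
      unfolding adjoint_rhs_def form_a_def w_def[symmetric] using int
      by (simp only: Bochner_Integration.integral_add Bochner_Integration.integral_diff
          Bochner_Integration.integrable_diff)
    finally show ?thesis by simp
  qed
  finally have "(LINT x|?M. k x * (w x \<bullet> w x) + e x * e x) = (LINT x|?M. ?A x \<bullet> w x + ?B x * e x)"
    unfolding form_a_def w_def[symmetric] .
  from weighted_energy_bound[OF A e(3) B e(1) k k_gt this]
  have "form_a D k e e \<le> (LINT x|?M. inverse (k x) * (norm (?A x))\<^sup>2 + \<bar>?B x\<bar>\<^sup>2)"
    unfolding form_a_def w_def[symmetric] .
  moreover have "(energy_norm D k e)\<^sup>2 = form_a D k e e"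
  proof -
    have "0 \<le> form_a D k e e"
      unfolding form_a_def using k_gt by (intro integral_nonneg_AE AE_I2) (simp add: less_imp_le)
    then show ?thesis by (simp add: energy_norm_def)
  qed
  ultimately show ?thesis unfolding e_def by simp
qed

end
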